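(* (1) There is an automorphism $\dot\Psi$ of the $\mathbb{Q}(\mathbf{t})$-algebra $\dot{\mathbf{U}}[\mathbf{t}]$ of order $4$ such that, for all $i\in I$ and $\lambda\in X$, $$\dot\Psi(1_\lambda)=1_\lambda,\quad\dot\Psi(E_i1_\lambda)=\mathbf{t}^{d_i\langle i,\lambda\rangle-\dot\phi(i,\lambda)}E_i1_\lambda,\quad\dot\Psi(F_i1_\lambda)=\mathbf{t}^{\dot\phi(i,\lambda)}F_i1_\lambda,$$ $$\dot\Psi(\pi)=-\pi,\quad\dot\Psi(v)=\mathbf{t}^{-1}v.$$ (2) The automorphism $\dot\Psi$ preserves the $\mathbb{Z}[v^{\pm1},\mathbf{t}]^\pi$-form ${}_{\mathbb{Z}}\dot{\mathbf{U}}[\mathbf{t}]$.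
   Context: Datum. $(I,\cdot)$ is a bar-consistent super Cartan datum of anisotropic type: $I$ is a finite set with a $\mathbb{Z}$-valued symmetric bilinear form $\cdot$ on the free abelian group $\mathbb{Z}[I]$ such that $d_i=\frac{i\cdot i}{2}\in\mathbb{Z}_{>0}$ for all $i\in I$ and $a_{ij}=2\frac{i\cdot j}{i\cdot i}\in\mathbb{Z}_{\le 0}$ for $i\ne j$ (for $i=j$ the same formula gives $a_{ii}=2$); there is a partition $I=I_{\bar 0}\sqcup I_{\bar 1}$ with $I_{\bar1}\neq\emptyset$, with parity $p(i)=0$ for $i\in I_{\bar 0}$ and $p(i)=1$ for $i\in I_{\bar 1}$; $a_{ij}\in 2\mathbb{Z}$ for $i\in I_{\bar 1}$, $j\in I$; and $d_i\equiv p(i)\bmod 2$ for all $i$. Put $b_{ij}=1-a_{ij}$. Fix a total order $<$ on $I$. A super root datum $(Y,X,I,\cdot)$ is given: finitely generated free abelian groups $Y,X$ with a perfect bilinear pairing $\langle\cdot,\cdot\rangle:Y\times X\to\mathbb{Z}$, and embeddings $I\subset X$ ($i\mapsto i'$), $I\subset Y$ ($i\mapsto i$), with linearly independent images, such that $\langle i,j'\rangle=a_{ij}$ for all $i,j\in I$. Extend $i\mapsto i'$ linearly to $\mathbb{Z}[I]\hookrightarrow X$, $\mu\mapsto\mu'$. Scalars. $v$ is a formal parameter, $\pi$ an indeterminate with $\pi^2=1$; for a ring $R$, $R^\pi=R[\pi]/(\pi^2-1)$. $\mathbf{t}$ is a square root of $-1$. Put $v_i=v^{d_i}$, $\pi_i=\pi^{d_i}$,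 $[n]_{v,\pi}=\frac{(\pi v)^n-v^{-n}}{\pi v-v^{-1}}$ ($n\in\mathbb{Z}$), $[n]^!_{v,\pi}=\prod_{l=1}^n[l]_{v,\pi}$, $\begin{bmatrix}n\\k\end{bmatrix}_{v,\pi}=\frac{\prod_{l=n-k+1}^n((\pi v)^l-v^{-l})}{\prod_{l=1}^k((\pi v)^l-v^{-l})}$. Modified covering quantum group. $\dot{\mathbf{U}}$ is the associative $\mathbb{Q}(v)^\pi$-algebra without unit generated by $1_\lambda,E_i1_\lambda,F_i1_\lambda$ ($\lambda\in X$, $i\in I$) subject to, for $i,j\in I$, $\lambda,\lambda'\in X$: $1_\lambda1_{\lambda'}=\delta_{\lambda,\lambda'}1_\lambda$; $(E_i1_\lambda)1_{\lambda'}=\delta_{\lambda,\lambda'}E_i1_\lambda$, $1_{\lambda'}(E_i1_\lambda)=\delta_{\lambda',\lambda+i'}E_i1_\lambda$; $(F_i1_\lambda)1_{\lambda'}=\delta_{\lambda,\lambda'}F_i1_\lambda$, $1_{\lambda'}(F_i1_\lambda)=\delta_{\lambda',\lambda-i'}F_i1_\lambda$; $(E_iF_j-\pi^{p(i)p(j)}F_jE_i)1_\lambda=\delta_{ij}[\langle i,\lambda\rangle]_{v_i,\pi_i}1_\lambda$; and for $i\ne j$, $\sum_{k=0}^{b_{ij}}(-1)^k\pi^{\binom k2p(i)+kp(i)p(j)}\begin{bmatrix}b_{ij}\\k\end{bmatrix}_{v_i,\pi_i}E_i^{b_{ij}-k}E_jE_i^k1_\lambda=0$, and the same relation with $F$ in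 place of $E$. Here products of $E$'s and $F$'s applied to $1_\lambda$ are read with the appropriate idempotents inserted, $xy1_\lambda=(x1_{\lambda+|y|})(y1_\lambda)$ with $|E_i|=i'$, $|F_i|=-i'$. Put $E_i^{(n)}1_\lambda=([n]^!_{v_i,\pi_i})^{-1}E_i^n1_\lambda$, and similarly $F_i^{(n)}1_\lambda$. ${}_{\mathbb{Z}}\dot{\mathbf{U}}$ is the $\mathbb{Z}[v^{\pm1}]^\pi$-subalgebra generated by $1_\lambda,E_i^{(n)}1_\lambda,F_i^{(n)}1_\lambda$ ($n\ge1$). Set $\dot{\mathbf{U}}[\mathbf{t}]=\mathbb{Q}(v,\mathbf{t})^\pi\otimes_{\mathbb{Q}(v)^\pi}\dot{\mathbf{U}}$ and ${}_{\mathbb{Z}}\dot{\mathbf{U}}[\mathbf{t}]=\mathbb{Z}[v^{\pm1},\mathbf{t}]^\pi\otimes_{\mathbb{Z}[v^{\pm1}]^\pi}{}_{\mathbb{Z}}\dot{\mathbf{U}}$. The function $\dot\phi$. Let $\phi:\mathbb{Z}[I]\times\mathbb{Z}[I]\to\mathbb{Z}$ be the bilinear form with $\phi(i,j)=d_ia_{ij}$ if $j<i$, $\phi(i,i)=d_i$, $\phi(i,j)=-2p(i)p(j)$ if $j>i$. Fix a transversal $C\subset X$ of coset representatives for $X/\mathbb{Z}[I]$, and define $\dot\phi:\mathbb{Z}[I]\times X\to\mathbb{Z}$ by $\dot\phi(\nu,\mu'+\lambda)=\phi(\nu,\mu)$ for $\nu,\mu\in\mathbb{Z}[I]$, $\lambda\in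 C$. The conditions $\dot\Psi(\pi)=-\pi$, $\dot\Psi(v)=\mathbf{t}^{-1}v$ mean that $\dot\Psi$ is semilinear with respect to the $\mathbb{Q}(\mathbf{t})$-algebra automorphism $\pi\mapsto-\pi$, $v\mapsto\mathbf{t}^{-1}v$ of $\mathbb{Q}(v,\mathbf{t})^\pi$. *)

theory Defs
  imports
    "HOL-Computational_Algebra.Polynomial"
    "HOL-Computational_Algebra.Fraction_Field"
    "HOL-Library.Poly_Mapping"
begin

section \<open>Scalars\<close>

text \<open>\<open>R[\<pi>]/(\<pi>\<^sup>2 - 1)\<close>, where \<open>PiExt a b\<close> is \<open>a + b \<pi>\<close>.\<close>

datatype 'a pi_ext = PiExt (pi_fst: 'a) (pi_snd: 'a)

instantiation pi_ext :: (comm_ring_1) comm_ring_1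
begin
definition "0 = PiExt 0 0"
definition "1 = PiExt 1 0"
definition "x + y = PiExt (pi_fst x + pi_fst y) (pi_snd x + pi_snd y)"
definition "- x = PiExt (- pi_fst x) (- pi_snd x)"
definition "x - y = PiExt (pi_fst x - pi_fst y) (pi_snd x - pi_snd y)"
definition "x * y = PiExt (pi_fst x * pi_fst y + pi_snd x * pi_snd y)
                          (pi_fst x * pi_snd y + pi_snd x * pi_fst y)"
instance
  by standard
    (auto simp: zero_pi_ext_def one_pi_ext_def plus_pi_ext_def uminus_pi_ext_def
      minus_pi_ext_def times_pi_ext_def algebra_simps)
end

text \<open>Division is meaningful only by the units of \<open>R[\<pi>]/(\<pi>\<^sup>2 - 1)\<close>; over a field these are the
  \<open>a + b \<pi>\<close> with \<open>a\<^sup>2 \<noteq> b\<^sup>2\<close>.\<close>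

instantiation pi_ext :: ("{comm_ring_1, inverse}") inverse
begin
definition "inverse x = PiExt (pi_fst x * inverse (pi_fst x * pi_fst x - pi_snd x * pi_snd x))
                      (- pi_snd x * inverse (pi_fst x * pi_fst x - pi_snd x * pi_snd x))"
definition "x div y = x * inverse (y :: 'a pi_ext)"
instance ..
end

lemma pi_ext_inverse:
  fixes x :: "'a::field pi_ext"
  assumes "pi_fst x * pi_fst x \<noteq> pi_snd x * pi_snd x"
  shows "x * inverse x = 1"
proof -
  define N where "N = pi_fst x * pi_fst x - pi_snd x * pi_snd x"
  have "N * inverse N = 1" using assms by (simp add: N_def)
  moreover have "x * inverse x = PiExt (N * inverse N) 0"
    unfolding inverse_pi_ext_def times_pi_ext_def N_def[symmetric]
    by (simp add: N_def left_diff_distrib mult.assoc)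
  ultimately show ?thesis by (simp add: one_pi_ext_def)
qed

text \<open>\<open>R[t]/(t\<^sup>2 + 1)\<close>, where \<open>TExt a b\<close> is \<open>a + b t\<close>. It is a field whenever \<open>R\<close> is an
  ordered field, in particular for \<open>R = \<rat>(v)\<close>, which is \<open>rat poly fract\<close>.\<close>

datatype 'a t_ext = TExt (t_fst: 'a) (t_snd: 'a)

instantiation t_ext :: (comm_ring_1) comm_ring_1
begin
definition "0 = TExt 0 0"
definition "1 = TExt 1 0"
definition "x + y = TExt (t_fst x + t_fst y) (t_snd x + t_snd y)"
definition "- x = TExt (- t_fst x) (- t_snd x)"
definition "x - y = TExt (t_fst x - t_fst y) (t_snd x - t_snd y)"
definition "x * y = TExt (t_fst x * t_fst y - t_snd x * t_snd y)
                         (t_fst x * t_snd y + t_snd x * t_fst y)"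
instance
  by standard
    (auto simp: zero_t_ext_def one_t_ext_def plus_t_ext_def uminus_t_ext_def
      minus_t_ext_def times_t_ext_def algebra_simps)
end

instantiation t_ext :: (linordered_field) field
begin
definition "inverse x = TExt (t_fst x / (t_fst x * t_fst x + t_snd x * t_snd x))
                     (- t_snd x / (t_fst x * t_fst x + t_snd x * t_snd x))"
definition "x div y = x * inverse (y :: 'a t_ext)"
instance
proof
  fix x :: "'a t_ext"
  assume "x \<noteq> 0"
  then have N: "t_fst x * t_fst x + t_snd x * t_snd x \<noteq> 0"
    by (cases x) (auto simp: zero_t_ext_def sum_squares_eq_zero_iff)
  show "inverse x * x = 1"
    using N
    by (simp add: inverse_t_ext_def times_t_ext_def one_t_ext_def add_divide_distrib[symmetric])
next
  show "inverse (0 :: 'a t_ext) = 0"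
    by (simp add: inverse_t_ext_def zero_t_ext_def)
qed (simp add: divide_t_ext_def)
end

type_synonym Qv = "rat poly fract"
type_synonym Qvp = "Qv pi_ext"
type_synonym Qvtp = "Qv t_ext pi_ext"

definition v_Qv :: Qv where "v_Qv = Fract [:0, 1:] 1"

definition vR :: Qvp where "vR = PiExt v_Qv 0"
definition piR :: Qvp where "piR = PiExt 0 1"

definition base_emb :: "Qvp \<Rightarrow> Qvtp" where
  "base_emb x = PiExt (TExt (pi_fst x) 0) (TExt (pi_snd x) 0)"

definition vS :: Qvtp where "vS = base_emb vR"
definition piS :: Qvtp where "piS = base_emb piR"
definition tS :: Qvtp where "tS = PiExt (TExt 0 1) 0"

definition Qt :: "Qvtp set" where
  "Qt = {PiExt (TExt (Fract [:a:] 1) (Fract [:b:] 1)) 0 | a b. True}"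

inductive_set subring_gen :: "'r::ring_1 set \<Rightarrow> 'r set" for G where
  gen: "g \<in> G \<Longrightarrow> g \<in> subring_gen G"
| one: "1 \<in> subring_gen G"
| diff: "x \<in> subring_gen G \<Longrightarrow> y \<in> subring_gen G \<Longrightarrow> x - y \<in> subring_gen G"
| mult: "x \<in> subring_gen G \<Longrightarrow> y \<in> subring_gen G \<Longrightarrow> x * y \<in> subring_gen G"

text \<open>\<open>\<int>[v\<^sup>\<plusminus>\<^sup>1]\<^sup>\<pi>\<close> and \<open>\<int>[v\<^sup>\<plusminus>\<^sup>1, t]\<^sup>\<pi>\<close> as subrings of \<open>\<rat>(v)\<^sup>\<pi>\<close> and \<open>\<rat>(v, t)\<^sup>\<pi>\<close>.\<close>

definition Zvp :: "Qvp set" where "Zvp = subring_gen {vR, inverse vR, piR}"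
definition Zvtp :: "Qvtp set" where "Zvtp = subring_gen {vS, inverse vS, tS, piS}"

definition ring_aut :: "('r::ring_1 \<Rightarrow> 'r) \<Rightarrow> bool" where
  "ring_aut \<sigma> \<longleftrightarrow> bij \<sigma> \<and> \<sigma> 1 = 1 \<and>
     (\<forall>x y. \<sigma> (x + y) = \<sigma> x + \<sigma> y) \<and> (\<forall>x y. \<sigma> (x * y) = \<sigma> x * \<sigma> y)"

definition twist_scalar_aut :: "(Qvtp \<Rightarrow> Qvtp) \<Rightarrow> bool" where
  "twist_scalar_aut \<sigma> \<longleftrightarrow> ring_aut \<sigma> \<and> (\<forall>c\<in>Qt. \<sigma> c = c) \<and> \<sigma> piS = - piS \<and>
     \<sigma> vS = inverse tS * vS"

definition qint :: "'r::{comm_ring_1, inverse} \<Rightarrow> 'r \<Rightarrow> int \<Rightarrow> 'r" where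
  "qint v p n = ((p * v) powi n - v powi (- n)) / (p * v - v powi (-1))"

definition qfact :: "'r::{comm_ring_1, inverse} \<Rightarrow> 'r \<Rightarrow> nat \<Rightarrow> 'r" where
  "qfact v p n = (\<Prod>l = 1..n. qint v p (int l))"

definition qbinom :: "'r::{comm_ring_1, inverse} \<Rightarrow> 'r \<Rightarrow> int \<Rightarrow> nat \<Rightarrow> 'r" where
  "qbinom v p n k =
     (\<Prod>l \<in> {n - int k + 1..n}. (p * v) powi l - v powi (- l)) /
     (\<Prod>l \<in> {1..int k}. (p * v) powi l - v powi (- l))"

section \<open>Abelian groups as \<open>\<int>\<close>-modules\<close>

definition zsmult :: "int \<Rightarrow> 'a::ab_group_add \<Rightarrow> 'a" where
  "zsmult n x = (\<Sum>k<nat n. x) - (\<Sum>k<nat (- n). x)"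

lemma zsmult_succ: "zsmult (n + 1) x = zsmult n x + x"
proof (cases "n \<ge> 0")
  case True
  then have "nat (n + 1) = Suc (nat n)" by simp
  then show ?thesis using True by (simp add: zsmult_def)
next
  case False
  then have "nat (- n) = Suc (nat (- (n + 1)))" "nat n = 0" "nat (n + 1) = 0" by auto
  then show ?thesis by (simp add: zsmult_def)
qed

lemma zsmult_add: "zsmult (m + n) x = zsmult m x + zsmult n x"
proof (induction n rule: int_induct[where k = 0])
  case base
  then show ?case by (simp add: zsmult_def)
next
  case (step1 i)
  then show ?case using zsmult_succ[of "m + i" x] zsmult_succ[of i x] by (simp add: algebra_simps)
next
  case (step2 i)
  then show ?case using zsmult_succ[of "m + i - 1" x] zsmult_succ[of "i - 1" x]
    by (simp add: algebra_simps)
qed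

lemma zsmult_mult: "zsmult m (zsmult n x) = zsmult (m * n) x"
proof (induction m rule: int_induct[where k = 0])
  case base
  then show ?case by (simp add: zsmult_def)
next
  case (step1 i)
  then show ?case using zsmult_succ[of i "zsmult n x"] zsmult_add[of "i * n" n x]
    by (simp add: algebra_simps)
next
  case (step2 i)
  then show ?case using zsmult_succ[of "i - 1" "zsmult n x"] zsmult_add[of "(i - 1) * n" n x]
    by (simp add: algebra_simps)
qed

interpretation zmod: module zsmult
proof
  fix a b :: int and x y :: 'a
  show "zsmult a (x + y) = zsmult a x + zsmult a y"
    by (simp add: zsmult_def sum.distrib)
  show "zsmult 1 x = x"
    by (simp add: zsmult_def)
qed (simp_all add: zsmult_add zsmult_mult)

definition fg_free :: "'a::ab_group_add itself \<Rightarrow> bool" where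
  "fg_free _ \<longleftrightarrow> (\<exists>B :: 'a set. finite B \<and> zmod.independent B \<and> zmod.span B = UNIV)"

definition biadditive :: "('a::ab_group_add \<Rightarrow> 'b::ab_group_add \<Rightarrow> 'c::ab_group_add) \<Rightarrow> bool" where
  "biadditive f \<longleftrightarrow> (\<forall>x. additive (f x)) \<and> (\<forall>y. additive (\<lambda>x. f x y))"

definition perfect_pairing :: "('y::ab_group_add \<Rightarrow> 'x::ab_group_add \<Rightarrow> int) \<Rightarrow> bool" where
  "perfect_pairing f \<longleftrightarrow> biadditive f \<and>
     (\<forall>g. additive g \<longrightarrow> (\<exists>!y. f y = g)) \<and> (\<forall>g. additive g \<longrightarrow> (\<exists>!x. (\<lambda>y. f y x) = g))"

section \<open>Super Cartan and root data\<close>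

text \<open>The set \<open>I\<close> is the type \<open>'i\<close>, the groups \<open>Y\<close> and \<open>X\<close> are the types \<open>'y\<close> and \<open>'x\<close>, and
  \<open>\<int>[I]\<close> is \<open>'i \<Rightarrow>\<^sub>0 int\<close>; \<open>sodd\<close> is the set of odd elements of \<open>I\<close>.\<close>

record ('i, 'y, 'x) super_datum =
  form :: "('i \<Rightarrow>\<^sub>0 int) \<Rightarrow> ('i \<Rightarrow>\<^sub>0 int) \<Rightarrow> int"
  sodd :: "'i set"
  pairing :: "'y \<Rightarrow> 'x \<Rightarrow> int"
  simple_coroot :: "'i \<Rightarrow> 'y"
  simple_root :: "'i \<Rightarrow> 'x"

definition sq :: "('i, 'y, 'x) super_datum \<Rightarrow> 'i \<Rightarrow> 'i \<Rightarrow> int" where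
  "sq D i j = form D (frag_of i) (frag_of j)"

definition dd :: "('i, 'y, 'x) super_datum \<Rightarrow> 'i \<Rightarrow> int" where
  "dd D i = sq D i i div 2"

definition cartan :: "('i, 'y, 'x) super_datum \<Rightarrow> 'i \<Rightarrow> 'i \<Rightarrow> int" where
  "cartan D i j = 2 * sq D i j div sq D i i"

definition par :: "('i, 'y, 'x) super_datum \<Rightarrow> 'i \<Rightarrow> nat" where
  "par D i = (if i \<in> sodd D then 1 else 0)"

definition bb :: "('i, 'y, 'x) super_datum \<Rightarrow> 'i \<Rightarrow> 'i \<Rightarrow> int" where
  "bb D i j = 1 - cartan D i j"

definition super_cartan_datum :: "('i::finite, 'y, 'x) super_datum \<Rightarrow> bool" where
  "super_cartan_datum D \<longleftrightarrow>
     biadditive (form D) \<and> (\<forall>\<mu> \<nu>. form D \<mu> \<nu> = form D \<nu> \<mu>) \<and>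
     (\<forall>i. even (sq D i i) \<and> dd D i > 0) \<and>
     (\<forall>i j. i \<noteq> j \<longrightarrow> sq D i i dvd 2 * sq D i j \<and> cartan D i j \<le> 0) \<and>
     sodd D \<noteq> {} \<and>
     (\<forall>i \<in> sodd D. \<forall>j. even (cartan D i j)) \<and>
     (\<forall>i. dd D i mod 2 = int (par D i) mod 2)"

definition super_root_datum ::
  "('i::finite, 'y::ab_group_add, 'x::ab_group_add) super_datum \<Rightarrow> bool" where
  "super_root_datum D \<longleftrightarrow>
     super_cartan_datum D \<and>
     fg_free TYPE('y) \<and> fg_free TYPE('x) \<and> perfect_pairing (pairing D) \<and>
     inj (simple_coroot D) \<and> zmod.independent (range (simple_coroot D)) \<and>
     inj (simple_root D) \<and> zmod.independent (range (simple_root D)) \<and>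
     (\<forall>i j. pairing D (simple_coroot D i) (simple_root D j) = cartan D i j)"

definition root_emb :: "('i::finite, 'y, 'x::ab_group_add) super_datum \<Rightarrow> ('i \<Rightarrow>\<^sub>0 int) \<Rightarrow> 'x" where
  "root_emb D \<mu> = (\<Sum>i\<in>UNIV. zsmult (Poly_Mapping.lookup \<mu> i) (simple_root D i))"

definition transversal ::
  "('i::finite, 'y, 'x::ab_group_add) super_datum \<Rightarrow> 'x set \<Rightarrow> bool" where
  "transversal D C \<longleftrightarrow> (\<forall>x. \<exists>!c. c \<in> C \<and> x - c \<in> range (root_emb D))"

definition phi0 :: "('i::linorder, 'y, 'x) super_datum \<Rightarrow> 'i \<Rightarrow> 'i \<Rightarrow> int" where
  "phi0 D i j =
     (if j < i then dd D i * cartan D i j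
      else if i = j then dd D i
      else - 2 * int (par D i) * int (par D j))"

definition phi ::
  "('i::{finite, linorder}, 'y, 'x) super_datum \<Rightarrow> ('i \<Rightarrow>\<^sub>0 int) \<Rightarrow> ('i \<Rightarrow>\<^sub>0 int) \<Rightarrow> int" where
  "phi D \<mu> \<nu> =
     (\<Sum>i\<in>UNIV. \<Sum>j\<in>UNIV. Poly_Mapping.lookup \<mu> i * Poly_Mapping.lookup \<nu> j * phi0 D i j)"

definition phidot ::
  "('i::{finite, linorder}, 'y, 'x::ab_group_add) super_datum \<Rightarrow> 'x set \<Rightarrow>
     ('i \<Rightarrow>\<^sub>0 int) \<Rightarrow> 'x \<Rightarrow> int" where
  "phidot D C \<nu> x = phi D \<nu> (THE \<mu>. \<exists>\<zeta>\<in>C. x = root_emb D \<mu> + \<zeta>)"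

section \<open>Algebras without unit\<close>

record ('r, 'm) nualg =
  nu_carrier :: "'m set"
  nu_zero :: 'm
  nu_add :: "'m \<Rightarrow> 'm \<Rightarrow> 'm"
  nu_mult :: "'m \<Rightarrow> 'm \<Rightarrow> 'm"
  nu_smult :: "'r \<Rightarrow> 'm \<Rightarrow> 'm"

text \<open>The associative \<open>'r\<close>-algebra without unit with generators \<open>'g\<close> and relations \<open>T\<close>: terms
  modulo the least congruence containing the algebra axioms and \<open>T\<close>.\<close>

datatype ('g, 'r) aterm =
  Zero
| Gen 'g
| Add "('g, 'r) aterm" "('g, 'r) aterm"
| Mul "('g, 'r) aterm" "('g, 'r) aterm"
| Smul 'r "('g, 'r) aterm"

inductive alg_cong ::
  "(('g, 'r::comm_ring_1) aterm \<times> ('g, 'r) aterm) set \<Rightarrow> ('g, 'r) aterm \<Rightarrow> ('g, 'r) aterm \<Rightarrow> bool"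
  for T where
  rel: "(x, y) \<in> T \<Longrightarrow> alg_cong T x y"
| refl: "alg_cong T x x"
| sym: "alg_cong T x y \<Longrightarrow> alg_cong T y x"
| trans: "alg_cong T x y \<Longrightarrow> alg_cong T y z \<Longrightarrow> alg_cong T x z"
| cong_Add: "alg_cong T x x' \<Longrightarrow> alg_cong T y y' \<Longrightarrow> alg_cong T (Add x y) (Add x' y')"
| cong_Mul: "alg_cong T x x' \<Longrightarrow> alg_cong T y y' \<Longrightarrow> alg_cong T (Mul x y) (Mul x' y')"
| cong_Smul: "alg_cong T x x' \<Longrightarrow> alg_cong T (Smul c x) (Smul c x')"
| Add_assoc: "alg_cong T (Add (Add x y) z) (Add x (Add y z))"
| Add_comm: "alg_cong T (Add x y) (Add y x)"
| Add_Zero: "alg_cong T (Add x Zero) x"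
| Smul_Add: "alg_cong T (Smul c (Add x y)) (Add (Smul c x) (Smul c y))"
| add_Smul: "alg_cong T (Smul (c + d) x) (Add (Smul c x) (Smul d x))"
| mult_Smul: "alg_cong T (Smul (c * d) x) (Smul c (Smul d x))"
| one_Smul: "alg_cong T (Smul 1 x) x"
| zero_Smul: "alg_cong T (Smul 0 x) Zero"
| Mul_assoc: "alg_cong T (Mul (Mul x y) z) (Mul x (Mul y z))"
| Mul_Add_left: "alg_cong T (Mul (Add x y) z) (Add (Mul x z) (Mul y z))"
| Mul_Add_right: "alg_cong T (Mul x (Add y z)) (Add (Mul x y) (Mul x z))"
| Mul_Smul_left: "alg_cong T (Mul (Smul c x) y) (Smul c (Mul x y))"
| Mul_Smul_right: "alg_cong T (Mul x (Smul c y)) (Smul c (Mul x y))"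

definition alg_rel ::
  "(('g, 'r::comm_ring_1) aterm \<times> ('g, 'r) aterm) set \<Rightarrow> (('g, 'r) aterm \<times> ('g, 'r) aterm) set" where
  "alg_rel T = {(x, y). alg_cong T x y}"

definition presented_alg ::
  "(('g, 'r::comm_ring_1) aterm \<times> ('g, 'r) aterm) set \<Rightarrow> ('r, ('g, 'r) aterm set) nualg" where
  "presented_alg T = \<lparr>
     nu_carrier = UNIV // alg_rel T,
     nu_zero = alg_rel T `` {Zero},
     nu_add = (\<lambda>X Y. \<Union>x\<in>X. \<Union>y\<in>Y. alg_rel T `` {Add x y}),
     nu_mult = (\<lambda>X Y. \<Union>x\<in>X. \<Union>y\<in>Y. alg_rel T `` {Mul x y}),
     nu_smult = (\<lambda>c X. \<Union>x\<in>X. alg_rel T `` {Smul c x}) \<rparr>"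

inductive_set subalg_gen :: "('r, 'm) nualg \<Rightarrow> 'r set \<Rightarrow> 'm set \<Rightarrow> 'm set" for U A G where
  gen: "g \<in> G \<Longrightarrow> g \<in> subalg_gen U A G"
| zero: "nu_zero U \<in> subalg_gen U A G"
| add: "x \<in> subalg_gen U A G \<Longrightarrow> y \<in> subalg_gen U A G \<Longrightarrow> nu_add U x y \<in> subalg_gen U A G"
| mult: "x \<in> subalg_gen U A G \<Longrightarrow> y \<in> subalg_gen U A G \<Longrightarrow> nu_mult U x y \<in> subalg_gen U A G"
| smult: "c \<in> A \<Longrightarrow> x \<in> subalg_gen U A G \<Longrightarrow> nu_smult U c x \<in> subalg_gen U A G"

text \<open>The tensor product \<open>B \<otimes>\<^sub>A M\<close> of an \<open>A\<close>-algebra \<open>B\<close> (via the ring homomorphism \<open>h\<close>) and an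
  \<open>A\<close>-algebra \<open>M\<close> without unit, where \<open>A\<close> and \<open>B\<close> are subrings of the rings \<open>'r\<close> and \<open>'s\<close>.
  A list \<open>[(s\<^sub>1, m\<^sub>1), \<dots>]\<close> stands for the formal sum \<open>s\<^sub>1 \<otimes> m\<^sub>1 + \<dots>\<close>; additive inverses exist since
  \<open>s \<otimes> m + (- s) \<otimes> m\<close> is \<open>0 \<otimes> m\<close>, which is \<open>0\<close>.\<close>

inductive tens_cong ::
  "'r set \<Rightarrow> ('r \<Rightarrow> 's::comm_ring_1) \<Rightarrow> 's set \<Rightarrow> ('r, 'm) nualg \<Rightarrow>
     ('s \<times> 'm) list \<Rightarrow> ('s \<times> 'm) list \<Rightarrow> bool"
  for A h B M where
  refl: "xs \<in> lists (B \<times> nu_carrier M) \<Longrightarrow> tens_cong A h B M xs xs"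
| sym: "tens_cong A h B M xs ys \<Longrightarrow> tens_cong A h B M ys xs"
| trans: "tens_cong A h B M xs ys \<Longrightarrow> tens_cong A h B M ys zs \<Longrightarrow> tens_cong A h B M xs zs"
| cong_add: "tens_cong A h B M xs xs' \<Longrightarrow> tens_cong A h B M ys ys' \<Longrightarrow>
    tens_cong A h B M (xs @ ys) (xs' @ ys')"
| add_comm: "xs \<in> lists (B \<times> nu_carrier M) \<Longrightarrow> ys \<in> lists (B \<times> nu_carrier M) \<Longrightarrow>
    tens_cong A h B M (xs @ ys) (ys @ xs)"
| zero: "m \<in> nu_carrier M \<Longrightarrow> tens_cong A h B M [(0, m)] []"
| add_left: "s \<in> B \<Longrightarrow> s' \<in> B \<Longrightarrow> m \<in> nu_carrier M \<Longrightarrow>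
    tens_cong A h B M [(s + s', m)] [(s, m), (s', m)]"
| add_right: "s \<in> B \<Longrightarrow> m \<in> nu_carrier M \<Longrightarrow> m' \<in> nu_carrier M \<Longrightarrow>
    tens_cong A h B M [(s, nu_add M m m')] [(s, m), (s, m')]"
| balanced: "s \<in> B \<Longrightarrow> a \<in> A \<Longrightarrow> m \<in> nu_carrier M \<Longrightarrow>
    tens_cong A h B M [(s * h a, m)] [(s, nu_smult M a m)]"

definition tens_rel ::
  "'r set \<Rightarrow> ('r \<Rightarrow> 's::comm_ring_1) \<Rightarrow> 's set \<Rightarrow> ('r, 'm) nualg \<Rightarrow>
     (('s \<times> 'm) list \<times> ('s \<times> 'm) list) set" where
  "tens_rel A h B M = {(xs, ys). tens_cong A h B M xs ys}"

definition tensor_alg ::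
  "'r set \<Rightarrow> ('r \<Rightarrow> 's::comm_ring_1) \<Rightarrow> 's set \<Rightarrow> ('r, 'm) nualg \<Rightarrow>
     ('s, ('s \<times> 'm) list set) nualg" where
  "tensor_alg A h B M = \<lparr>
     nu_carrier = lists (B \<times> nu_carrier M) // tens_rel A h B M,
     nu_zero = tens_rel A h B M `` {[]},
     nu_add = (\<lambda>X Y. \<Union>xs\<in>X. \<Union>ys\<in>Y. tens_rel A h B M `` {xs @ ys}),
     nu_mult = (\<lambda>X Y. \<Union>xs\<in>X. \<Union>ys\<in>Y.
       tens_rel A h B M `` {[(s * s', nu_mult M m m'). (s, m) \<leftarrow> xs, (s', m') \<leftarrow> ys]}),
     nu_smult = (\<lambda>c X. \<Union>xs\<in>X. tens_rel A h B M `` {[(c * s, m). (s, m) \<leftarrow> xs]}) \<rparr>"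

definition semilinear_aut ::
  "('s \<Rightarrow> 's) \<Rightarrow> ('s, 'm) nualg \<Rightarrow> ('m \<Rightarrow> 'm) \<Rightarrow> bool" where
  "semilinear_aut \<sigma> U f \<longleftrightarrow>
     bij_betw f (nu_carrier U) (nu_carrier U) \<and>
     (\<forall>x\<in>nu_carrier U. \<forall>y\<in>nu_carrier U. f (nu_add U x y) = nu_add U (f x) (f y)) \<and>
     (\<forall>x\<in>nu_carrier U. \<forall>y\<in>nu_carrier U. f (nu_mult U x y) = nu_mult U (f x) (f y)) \<and>
     (\<forall>c. \<forall>x\<in>nu_carrier U. f (nu_smult U c x) = nu_smult U (\<sigma> c) (f x))"

definition has_order_on :: "('m \<Rightarrow> 'm) \<Rightarrow> 'm set \<Rightarrow> nat \<Rightarrow> bool" where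
  "has_order_on f S n \<longleftrightarrow> 0 < n \<and> (\<forall>x\<in>S. (f ^^ n) x = x) \<and>
     (\<forall>m. 0 < m \<and> m < n \<longrightarrow> (\<exists>x\<in>S. (f ^^ m) x \<noteq> x))"

section \<open>The modified covering quantum group\<close>

text \<open>\<open>Idem \<zeta>\<close> is \<open>1\<^sub>\<zeta>\<close> and \<open>Chev (E i) \<zeta>\<close>, \<open>Chev (F i) \<zeta>\<close> are \<open>E\<^sub>i 1\<^sub>\<zeta>\<close>, \<open>F\<^sub>i 1\<^sub>\<zeta>\<close>.\<close>

datatype 'i letter = E 'i | F 'i

datatype ('i, 'x) ugen = Idem 'x | Chev "'i letter" 'x

type_synonym ('i, 'x) uterm = "(('i, 'x) ugen, Qvp) aterm"

fun wt :: "('i, 'y, 'x::ab_group_add) super_datum \<Rightarrow> 'i letter \<Rightarrow> 'x" where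
  "wt D (E i) = simple_root D i"
| "wt D (F i) = - simple_root D i"

text \<open>\<open>umono D [x\<^sub>1, \<dots>, x\<^sub>n] \<zeta>\<close> is \<open>x\<^sub>1 \<cdots> x\<^sub>n 1\<^sub>\<zeta>\<close> with the intermediate idempotents inserted.\<close>

fun umono :: "('i, 'y, 'x::ab_group_add) super_datum \<Rightarrow> 'i letter list \<Rightarrow> 'x \<Rightarrow> ('i, 'x) uterm" where
  "umono D [] \<zeta> = Gen (Idem \<zeta>)"
| "umono D (x # xs) \<zeta> = Mul (Gen (Chev x (\<zeta> + sum_list (map (wt D) xs)))) (umono D xs \<zeta>)"

definition v_at :: "('i, 'y, 'x) super_datum \<Rightarrow> 'i \<Rightarrow> Qvp" where
  "v_at D i = vR powi dd D i"

definition pi_at :: "('i, 'y, 'x) super_datum \<Rightarrow> 'i \<Rightarrow> Qvp" where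
  "pi_at D i = piR powi dd D i"

definition serre ::
  "('i, 'y, 'x::ab_group_add) super_datum \<Rightarrow> ('i \<Rightarrow> 'i letter) \<Rightarrow> 'i \<Rightarrow> 'i \<Rightarrow> 'x \<Rightarrow> ('i, 'x) uterm" where
  "serre D L i j \<zeta> = (let b = nat (bb D i j) in
     foldr Add
       (map (\<lambda>k. Smul ((-1) ^ k * piR ^ ((k choose 2) * par D i + k * par D i * par D j) *
                        qbinom (v_at D i) (pi_at D i) (bb D i j) k)
                  (umono D (replicate (b - k) (L i) @ [L j] @ replicate k (L i)) \<zeta>))
            [0..<Suc b])
       Zero)"

inductive_set udot_rels ::
  "('i, 'y, 'x::ab_group_add) super_datum \<Rightarrow> (('i, 'x) uterm \<times> ('i, 'x) uterm) set" for D where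
  idem: "(Mul (Gen (Idem \<zeta>)) (Gen (Idem \<zeta>')),
          if \<zeta> = \<zeta>' then Gen (Idem \<zeta>) else Zero) \<in> udot_rels D"
| right: "(Mul (Gen (Chev x \<zeta>)) (Gen (Idem \<zeta>')),
           if \<zeta> = \<zeta>' then Gen (Chev x \<zeta>) else Zero) \<in> udot_rels D"
| left: "(Mul (Gen (Idem \<zeta>')) (Gen (Chev x \<zeta>)),
          if \<zeta>' = \<zeta> + wt D x then Gen (Chev x \<zeta>) else Zero) \<in> udot_rels D"
| comm: "(Add (umono D [E i, F j] \<zeta>) (Smul (- (piR ^ (par D i * par D j))) (umono D [F j, E i] \<zeta>)),
          if i = j
          then Smul (qint (v_at D i) (pi_at D i) (pairing D (simple_coroot D i) \<zeta>)) (Gen (Idem \<zeta>))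
          else Zero) \<in> udot_rels D"
| serre_E: "i \<noteq> j \<Longrightarrow> (serre D E i j \<zeta>, Zero) \<in> udot_rels D"
| serre_F: "i \<noteq> j \<Longrightarrow> (serre D F i j \<zeta>, Zero) \<in> udot_rels D"

definition Udot ::
  "('i, 'y, 'x::ab_group_add) super_datum \<Rightarrow> (Qvp, ('i, 'x) uterm set) nualg" where
  "Udot D = presented_alg (udot_rels D)"

definition uclass ::
  "('i, 'y, 'x::ab_group_add) super_datum \<Rightarrow> ('i, 'x) uterm \<Rightarrow> ('i, 'x) uterm set" where
  "uclass D x = alg_rel (udot_rels D) `` {x}"

definition divpow ::
  "('i, 'y, 'x::ab_group_add) super_datum \<Rightarrow> ('i \<Rightarrow> 'i letter) \<Rightarrow> 'i \<Rightarrow> nat \<Rightarrow> 'x \<Rightarrow>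
     ('i, 'x) uterm set" where
  "divpow D L i n \<zeta> =
     nu_smult (Udot D) (inverse (qfact (v_at D i) (pi_at D i) n))
       (uclass D (umono D (replicate n (L i)) \<zeta>))"

definition ZUdot ::
  "('i, 'y, 'x::ab_group_add) super_datum \<Rightarrow> (Qvp, ('i, 'x) uterm set) nualg" where
  "ZUdot D = (Udot D)\<lparr>nu_carrier := subalg_gen (Udot D) Zvp
     ({uclass D (Gen (Idem \<zeta>)) | \<zeta>. True} \<union>
      {divpow D L i n \<zeta> | L i n \<zeta>. L \<in> {E, F} \<and> n \<ge> 1})\<rparr>"

definition Udot_t ::
  "('i, 'y, 'x::ab_group_add) super_datum \<Rightarrow>
     (Qvtp, (Qvtp \<times> ('i, 'x) uterm set) list set) nualg" where
  "Udot_t D = tensor_alg UNIV base_emb UNIV (Udot D)"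

definition ZUdot_t ::
  "('i, 'y, 'x::ab_group_add) super_datum \<Rightarrow>
     (Qvtp, (Qvtp \<times> ('i, 'x) uterm set) list set) nualg" where
  "ZUdot_t D = tensor_alg Zvp base_emb Zvtp (ZUdot D)"

text \<open>The natural map \<open>ZUdot_t D \<rightarrow> Udot_t D\<close>, \<open>s \<otimes> u \<mapsto> s \<otimes> u\<close>. It is injective, as \<open>1, t\<close> is a basis
  of \<open>\<rat>(v, t)\<^sup>\<pi>\<close> over \<open>\<rat>(v)\<^sup>\<pi>\<close> and of \<open>\<int>[v\<^sup>\<plusminus>\<^sup>1, t]\<^sup>\<pi>\<close> over \<open>\<int>[v\<^sup>\<plusminus>\<^sup>1]\<^sup>\<pi>\<close>; its image is the integral form
  viewed inside \<open>Udot_t D\<close>.\<close>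

definition form_incl ::
  "('i, 'y, 'x::ab_group_add) super_datum \<Rightarrow> (Qvtp \<times> ('i, 'x) uterm set) list set \<Rightarrow>
     (Qvtp \<times> ('i, 'x) uterm set) list set" where
  "form_incl D X = (\<Union>xs\<in>X. tens_rel UNIV base_emb UNIV (Udot D) `` {xs})"

definition integral_form ::
  "('i, 'y, 'x::ab_group_add) super_datum \<Rightarrow> (Qvtp \<times> ('i, 'x) uterm set) list set set" where
  "integral_form D = form_incl D ` nu_carrier (ZUdot_t D)"

definition ugen_t ::
  "('i, 'y, 'x::ab_group_add) super_datum \<Rightarrow> ('i, 'x) ugen \<Rightarrow>
     (Qvtp \<times> ('i, 'x) uterm set) list set" where
  "ugen_t D g = tens_rel UNIV base_emb UNIV (Udot D) `` {[(1, uclass D (Gen g))]}"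

end

theory Submission
  imports Defs
begin

text \<open>The scalar automorphism \<sigma> fixes \<open>t\<close> and sends \<open>v\<close> to \<open>t\<^sup>-\<^sup>1 v\<close> and \<open>\<pi>\<close> to \<open>-\<pi> = t\<^sup>2 \<pi>\<close>. Hence, with
  \<open>d = d\<^sub>i\<close>, it sends \<open>\<pi>\<^sub>i v\<^sub>i\<close> to \<open>t\<^sup>d \<pi>\<^sub>i v\<^sub>i\<close> and \<open>v\<^sub>i\<^sup>-\<^sup>1\<close> to \<open>t\<^sup>d v\<^sub>i\<^sup>-\<^sup>1\<close>: the two terms of
  \<open>(\<pi>\<^sub>i v\<^sub>i)\<^sup>n - v\<^sub>i\<^sup>-\<^sup>n\<close> acquire the same factor, so every quantum integer, factorial or binomial is only
  multiplied by a power of \<open>t\<close> (lemmas \<open>twist_qint\<close>, \<open>twist_qfact\<close>, \<open>twist_qbinom\<close>).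
  
  Likewise, if each generator is multiplied by the prescribed power of \<open>t\<close>, then each monomial in the
  generators is multiplied by a power of \<open>t\<close> (\<open>scaled_umono\<close>). A relation of the algebra is therefore
  preserved as soon as all of its terms acquire the same power of \<open>t\<close>, that is, as soon as some
  integer exponents agree modulo 4. Because the exponents on the generators are affine along the root
  lattice, interchanging two neighbouring letters of a monomial changes its exponent by a constant, and
  the whole comparison reduces to the congruence
  \<open>\<phi>(i,j) - \<phi>(j,i) \<equiv> d\<^sub>i a\<^sub>i\<^sub>j + 2 p(i) p(j)\<close> modulo 4 (\<open>phi0_antisym\<close>) together with \<open>d\<^sub>i \<equiv> p(i)\<close>
  modulo 2. This gives the commutator relation (\<open>scaled_comm_left\<close>, \<open>scaled_comm_right\<close>) and the
  Serre relations (\<open>scaled_serre\<close>).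
  
  The universal properties of an algebra with generators and relations and of an extension of scalars
  then produce a \<sigma>-semilinear endomorphism \<open>Psi\<close>. Its fourth power is linear, since \<open>\<sigma>\<^sup>4 = 1\<close>, and fixes
  each generator, since \<open>t\<^sup>4 = 1\<close>; so \<open>Psi\<close> is bijective and \<open>Psi\<^sup>4 = 1\<close>. On \<open>v 1\<^sub>0\<close> its powers act by
  \<open>v \<mapsto> (-t)\<^sup>m v\<close>, and \<open>1\<^sub>0\<close> is annihilated by no nonzero scalar because it acts as the identity in the
  trivial one-dimensional module; hence the order is exactly 4.
  
  The integral form is the subalgebra over \<open>\<int>[v\<^sup>\<plusminus>\<^sup>1, t]\<^sup>\<pi>\<close> generated by the idempotents and the divided powers
  (\<open>integral_form_eq\<close>). \<open>Psi\<close> multiplies these generators by powers of \<open>t\<close>, so it maps the form into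
  itself, and onto itself because its inverse is \<open>Psi\<^sup>3\<close>.\<close>

section \<open>Ring homomorphisms\<close>

locale ring_map =
  fixes h :: "'r::comm_ring_1 \<Rightarrow> 's::comm_ring_1"
  assumes one [simp]: "h 1 = 1"
    and add [simp]: "h (x + y) = h x + h y"
    and mult [simp]: "h (x * y) = h x * h y"
begin

lemma zero [simp]: "h 0 = 0"
  using add[of 0 0] by simp

lemma minus [simp]: "h (- x) = - h x"
  using add[of x "- x"] by (simp add: eq_neg_iff_add_eq_0 add.commute)

lemma diff [simp]: "h (x - y) = h x - h y"
  using add[of x "- y"] by simp

lemma power [simp]: "h (x ^ n) = h x ^ n"
  by (induction n) simp_all

lemma prod [simp]: "h (\<Prod>a\<in>A. f a) = (\<Prod>a\<in>A. h (f a))"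
  by (induction A rule: infinite_finite_induct) simp_all

end

lemma ring_map_comp: "ring_map g \<Longrightarrow> ring_map h \<Longrightarrow> ring_map (g \<circ> h)"
  by (simp add: ring_map_def)

lemma ring_map_id: "ring_map (\<lambda>x. x)"
  by (simp add: ring_map_def)

lemma ring_map_inverse:
  fixes h :: "'a::field \<Rightarrow> 'b::field"
  assumes "ring_map h"
  shows "h (inverse x) = inverse (h x)"
proof (cases "x = 0")
  case True
  then show ?thesis using ring_map.zero[OF assms] by simp
next
  case False
  then have "h x * h (inverse x) = 1"
    using ring_map.mult[OF assms, of x "inverse x"] ring_map.one[OF assms] by simp
  then show ?thesis by (simp add: inverse_unique)
qed

section \<open>The scalar automorphism\<close>

text \<open>The automorphism is built in stages: first \<open>p(v) \<mapsto> p(-t v)\<close> on polynomials with values in the field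
  \<open>\<rat>(v, t)\<close>, then on fractions \<open>\<rat>(v)\<close>, then \<open>t\<close>-linearly on \<open>\<rat>(v, t)\<close>, and finally with \<open>\<pi> \<mapsto> -\<pi>\<close> on
  \<open>\<rat>(v, t)\<^sup>\<pi>\<close>.\<close>

definition rat_cst :: "rat \<Rightarrow> Qv t_ext" where
  "rat_cst a = TExt (Fract [:a:] 1) 0"

definition vT :: "Qv t_ext" where "vT = TExt v_Qv 0"
definition tT :: "Qv t_ext" where "tT = TExt 0 1"

lemma ring_map_rat_cst: "ring_map rat_cst"
  by standard
    (simp_all add: rat_cst_def one_t_ext_def plus_t_ext_def times_t_ext_def One_fract_def Zero_fract_def mult.commute
      flip: one_pCons)

lemma tT_square: "tT * tT = -1"
  by (simp add: tT_def times_t_ext_def one_t_ext_def uminus_t_ext_def)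

definition subst_poly :: "rat poly \<Rightarrow> Qv t_ext" where
  "subst_poly p = fold_coeffs (\<lambda>a r. rat_cst a + (- tT * vT) * r) p 0"

lemma subst_poly_0: "subst_poly 0 = 0"
  by (simp add: subst_poly_def)

lemma subst_poly_pCons: "subst_poly (pCons a p) = rat_cst a + (- tT * vT) * subst_poly p"
  using ring_map.zero[OF ring_map_rat_cst]
  by (cases "a = 0 \<and> p = 0") (auto simp: subst_poly_def)

lemma subst_poly_add: "subst_poly (p + q) = subst_poly p + subst_poly q"
  by (induction p q rule: poly_induct2)
    (simp_all add: subst_poly_0 subst_poly_pCons ring_map.add[OF ring_map_rat_cst] algebra_simps)

lemma subst_poly_smult: "subst_poly (smult a p) = rat_cst a * subst_poly p"
  by (induction p)
    (simp_all add: subst_poly_0 subst_poly_pCons ring_map.mult[OF ring_map_rat_cst] algebra_simps)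

lemma ring_map_subst_poly: "ring_map subst_poly"
proof
  show "subst_poly 1 = 1"
    by (simp add: one_pCons subst_poly_pCons subst_poly_0 ring_map.one[OF ring_map_rat_cst])
  show "subst_poly (p * q) = subst_poly p * subst_poly q" for p q
    by (induction p)
      (simp_all add: subst_poly_0 subst_poly_pCons subst_poly_add subst_poly_smult
        ring_map.zero[OF ring_map_rat_cst] algebra_simps)
qed (rule subst_poly_add)

text \<open>The passage to fractions needs \<open>p(-t v) \<noteq> 0\<close> for \<open>p \<noteq> 0\<close>. Splitting \<open>p(-t v) = r(v) + t s(v)\<close>, each
  coefficient of \<open>p\<close> occurs up to sign in exactly one of \<open>r\<close> and \<open>s\<close>, so both vanish only for \<open>p = 0\<close>.\<close>

lemma subst_poly_parts:
  "\<exists>r s. subst_poly p = TExt (Fract r 1) (Fract s 1) \<and> (r = 0 \<and> s = 0 \<longrightarrow> p = 0)"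
proof (induction p)
  case 0
  then show ?case
    by (intro exI[of _ 0]) (simp add: subst_poly_0 zero_t_ext_def Zero_fract_def)
next
  case (pCons a p)
  then obtain r s where IH: "subst_poly p = TExt (Fract r 1) (Fract s 1)" "r = 0 \<and> s = 0 \<longrightarrow> p = 0"
    by blast
  have "subst_poly (pCons a p) = TExt (Fract (pCons a s) 1) (Fract (pCons 0 (- r)) 1)"
    by (simp add: subst_poly_pCons IH(1) rat_cst_def tT_def vT_def v_Qv_def times_t_ext_def
        plus_t_ext_def uminus_t_ext_def Zero_fract_def)
  then show ?case
    using IH(2) by (intro exI[of _ "pCons a s"] exI[of _ "pCons 0 (- r)"]) simp
qed

lemma subst_poly_eq_0: "subst_poly p = 0 \<longleftrightarrow> p = 0"
  using subst_poly_parts[of p] subst_poly_0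
  by (auto simp: zero_t_ext_def Zero_fract_def eq_fract)

text \<open>The value does not depend on the chosen representative (\<open>subst_fract_Fract\<close>).\<close>

definition subst_fract :: "Qv \<Rightarrow> Qv t_ext" where
  "subst_fract x = (let (a, b) = SOME (a, b). b \<noteq> 0 \<and> x = Fract a b in subst_poly a / subst_poly b)"

lemma subst_fract_Fract:
  assumes "b \<noteq> 0"
  shows "subst_fract (Fract a b) = subst_poly a / subst_poly b"
proof -
  define P where "P = (\<lambda>(a', b'). b' \<noteq> 0 \<and> Fract a b = Fract a' b')"
  obtain a' b' where ab': "(SOME z. P z) = (a', b')" by force
  have "P (a, b)" using assms by (simp add: P_def)
  then have "P (a', b')" using someI[of P] ab' by metis
  then have *: "b' \<noteq> 0" "a * b' = a' * b"
    using assms eq_fract(1)[of b b' a a'] by (auto simp: P_def)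
  then have "subst_poly a * subst_poly b' = subst_poly a' * subst_poly b"
    by (metis ring_map.mult[OF ring_map_subst_poly])
  moreover have "subst_fract (Fract a b) = subst_poly a' / subst_poly b'"
    using ab' by (simp add: subst_fract_def P_def)
  ultimately show ?thesis
    using assms *(1) by (simp add: frac_eq_eq subst_poly_eq_0)
qed

lemma ring_map_subst_fract: "ring_map subst_fract"
proof -
  interpret S: ring_map subst_poly by (rule ring_map_subst_poly)
  show ?thesis
  proof
    show "subst_fract 1 = 1"
      by (simp add: One_fract_def subst_fract_Fract)
    fix x y :: Qv
    obtain a b c d where xy: "x = Fract a b" "y = Fract c d" "b \<noteq> 0" "d \<noteq> 0"
      by (metis Fract_cases)
    show "subst_fract (x + y) = subst_fract x + subst_fract y"
      using xy by (simp add: subst_fract_Fract subst_poly_eq_0 add_frac_eq algebra_simps)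
    show "subst_fract (x * y) = subst_fract x * subst_fract y"
      using xy by (simp add: subst_fract_Fract)
  qed
qed

definition twist_field :: "Qv t_ext \<Rightarrow> Qv t_ext" where
  "twist_field x = subst_fract (t_fst x) + tT * subst_fract (t_snd x)"

lemma ring_map_twist_field: "ring_map twist_field"
proof -
  interpret S: ring_map subst_fract by (rule ring_map_subst_fract)
  show ?thesis
  proof
    show "twist_field 1 = 1"
      by (simp add: twist_field_def one_t_ext_def)
    show "twist_field (x + y) = twist_field x + twist_field y" for x y
    proof -
      have "t_fst (x + y) = t_fst x + t_fst y" "t_snd (x + y) = t_snd x + t_snd y"
        by (simp_all add: plus_t_ext_def)
      then show ?thesis by (simp add: twist_field_def algebra_simps)
    qed
    show "twist_field (x * y) = twist_field x * twist_field y" for x y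
    proof -
      have *: "tT * (tT * z) = - z" for z
        using tT_square by (metis mult.assoc mult_minus1)
      have "t_fst (x * y) = t_fst x * t_fst y - t_snd x * t_snd y"
        "t_snd (x * y) = t_fst x * t_snd y + t_snd x * t_fst y"
        by (simp_all add: times_t_ext_def)
      then have "twist_field (x * y) =
          subst_fract (t_fst x) * subst_fract (t_fst y) - subst_fract (t_snd x) * subst_fract (t_snd y) +
          tT * (subst_fract (t_fst x) * subst_fract (t_snd y) + subst_fract (t_snd x) * subst_fract (t_fst y))"
        by (simp add: twist_field_def)
      then show ?thesis
        by (simp add: twist_field_def algebra_simps *)
    qed
  qed
qed

lemma twist_field_rat_cst: "twist_field (rat_cst a) = rat_cst a"
proof -
  interpret S: ring_map subst_fract by (rule ring_map_subst_fract)
  show ?thesis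
    by (simp add: twist_field_def rat_cst_def subst_fract_Fract subst_poly_pCons subst_poly_0
        ring_map.one[OF ring_map_subst_poly])
qed

lemma twist_field_tT: "twist_field tT = tT"
  using ring_map.zero[OF ring_map_subst_fract] ring_map.one[OF ring_map_subst_fract]
  by (simp add: twist_field_def tT_def)

lemma twist_field_vT: "twist_field vT = - tT * vT"
  using ring_map.zero[OF ring_map_subst_fract] ring_map.one[OF ring_map_subst_poly]
    ring_map.zero[OF ring_map_rat_cst] ring_map.one[OF ring_map_rat_cst]
  by (simp add: twist_field_def vT_def v_Qv_def subst_fract_Fract subst_poly_pCons subst_poly_0)

text \<open>\<open>\<rat>(v, t)\<close> is generated as a field by \<open>\<rat>\<close>, \<open>v\<close> and \<open>t\<close>. This turns \<open>\<sigma>\<^sup>4 = 1\<close> into a check on \<open>v\<close> and \<open>t\<close>.\<close>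

lemma Qvt_ring_map_eq_id:
  assumes g: "ring_map g" and cst: "\<And>a. g (rat_cst a) = rat_cst a"
    and v: "g vT = vT" and t: "g tT = tT"
  shows "g x = x"
proof -
  interpret g: ring_map g by (rule g)
  have poly: "g (TExt (Fract p 1) 0) = TExt (Fract p 1) 0" for p
  proof (induction p)
    case 0
    then show ?case using cst[of 0] by (simp add: rat_cst_def)
  next
    case (pCons a p)
    have "TExt (Fract (pCons a p) 1) 0 = rat_cst a + vT * TExt (Fract p 1) 0"
      by (simp add: rat_cst_def vT_def v_Qv_def times_t_ext_def plus_t_ext_def)
    then show ?case using cst[of a] v pCons(2) by simp
  qed
  have real: "g (TExt y 0) = TExt y 0" for y
  proof -
    obtain a b where y: "y = Fract a b" "b \<noteq> 0" by (metis Fract_cases)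
    have "TExt (c / d) 0 = TExt c 0 * inverse (TExt d 0)" for c d :: Qv
      by (simp add: times_t_ext_def inverse_t_ext_def)
    from this[of "Fract a 1" "Fract b 1"]
    have "TExt y 0 = TExt (Fract a 1) 0 * inverse (TExt (Fract b 1) 0)"
      using y by simp
    then show ?thesis by (simp add: poly ring_map_inverse[OF g])
  qed
  have "x = TExt (t_fst x) 0 + tT * TExt (t_snd x) 0"
    by (cases x) (simp add: tT_def times_t_ext_def plus_t_ext_def)
  then show ?thesis using g.add g.mult real t by metis
qed

lemma twist_field_order: "twist_field (twist_field (twist_field (twist_field x))) = x"
proof -
  let ?F = "twist_field \<circ> (twist_field \<circ> (twist_field \<circ> twist_field))"
  interpret T: ring_map twist_field by (rule ring_map_twist_field)
  have t: "tT * (tT * z) = - z" for z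
    using tT_square by (metis mult.assoc mult_minus1)
  have "?F x = x"
  proof (rule Qvt_ring_map_eq_id)
    show "ring_map ?F" by (intro ring_map_comp ring_map_twist_field)
  qed (simp_all add: twist_field_rat_cst twist_field_tT twist_field_vT t)
  then show ?thesis by simp
qed

definition twist :: "Qvtp \<Rightarrow> Qvtp" where
  "twist x = PiExt (twist_field (pi_fst x)) (- twist_field (pi_snd x))"

lemma ring_map_twist: "ring_map twist"
proof -
  interpret T: ring_map twist_field by (rule ring_map_twist_field)
  show ?thesis
    by standard
      (simp_all add: twist_def one_pi_ext_def plus_pi_ext_def times_pi_ext_def algebra_simps)
qed

lemma twist_order: "twist (twist (twist (twist x))) = x"
  using ring_map.minus[OF ring_map_twist_field] by (simp add: twist_def twist_field_order)

lemma twist_inverse: "twist (inverse x) = inverse (twist x)"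
proof -
  interpret T: ring_map twist_field by (rule ring_map_twist_field)
  show ?thesis
    by (simp add: twist_def inverse_pi_ext_def ring_map_inverse[OF ring_map_twist_field])
qed

lemma ring_map_base_emb: "ring_map base_emb"
  by standard
    (simp_all add: base_emb_def one_pi_ext_def one_t_ext_def zero_t_ext_def plus_pi_ext_def
      plus_t_ext_def times_pi_ext_def times_t_ext_def)

lemma base_emb_inverse: "base_emb (inverse x) = inverse (base_emb x)"
proof -
  have "ring_map (\<lambda>x::Qv. TExt x 0)"
    by standard (simp_all add: one_t_ext_def plus_t_ext_def times_t_ext_def)
  from ring_map_inverse[OF this] have *: "inverse (TExt y 0) = TExt (inverse y) 0" for y :: Qv
    by simp
  show ?thesis
    by (simp add: base_emb_def inverse_pi_ext_def times_t_ext_def minus_t_ext_def uminus_t_ext_def *)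
qed

lemma inverse_tS: "inverse tS = - tS"
  by (simp add: tS_def inverse_pi_ext_def inverse_t_ext_def times_t_ext_def minus_t_ext_def
      uminus_t_ext_def uminus_pi_ext_def zero_t_ext_def)

lemma tS_square: "tS * tS = -1"
  by (simp add: tS_def times_pi_ext_def times_t_ext_def one_pi_ext_def one_t_ext_def uminus_pi_ext_def
      uminus_t_ext_def zero_t_ext_def)

lemma twist_tS: "twist tS = tS"
  using twist_field_tT ring_map.zero[OF ring_map_twist_field] by (simp add: twist_def tS_def tT_def)

lemma twist_piS: "twist piS = - piS"
  using ring_map.one[OF ring_map_twist_field] ring_map.zero[OF ring_map_twist_field]
  by (simp add: twist_def piS_def piR_def base_emb_def uminus_pi_ext_def flip: zero_t_ext_def one_t_ext_def)

lemma twist_vS: "twist vS = inverse tS * vS"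
  using twist_field_vT ring_map.zero[OF ring_map_twist_field] unfolding inverse_tS
  by (simp add: twist_def vS_def vR_def base_emb_def vT_def tT_def tS_def times_pi_ext_def
      uminus_pi_ext_def flip: zero_t_ext_def)

lemma twist_scalar_aut_twist: "twist_scalar_aut twist"
  unfolding twist_scalar_aut_def ring_aut_def
proof (intro conjI ballI allI)
  show "bij twist"
    by (rule o_bij[of "\<lambda>x. twist (twist (twist x))"]) (auto simp: twist_order)
  fix c assume "c \<in> Qt"
  then obtain a b where "c = PiExt (rat_cst a + tT * rat_cst b) 0"
    by (auto simp: Qt_def rat_cst_def tT_def times_t_ext_def plus_t_ext_def)
  then show "twist c = c"
    using ring_map_twist_field
    by (simp add: twist_def ring_map.add ring_map.mult ring_map.zero twist_field_rat_cst twist_field_tT)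
qed (simp_all add: ring_map.one ring_map.add ring_map.mult ring_map_twist twist_piS twist_vS)

section \<open>Integer powers and quantum integers\<close>

text \<open>Rings \<open>K[\<pi>]/(\<pi>\<^sup>2 - 1)\<close> are not fields, so the laws of integer powers have to be derived here. The
  inverse of \<open>a + b \<pi>\<close> is its conjugate \<open>a - b \<pi>\<close> divided by the norm \<open>a\<^sup>2 - b\<^sup>2\<close>. The norm is multiplicative
  and division by 0 gives 0 in \<open>K\<close>, so \<open>inverse\<close> is multiplicative even on non-units.\<close>

lemma pi_ext_inverse_mult:
  fixes x y :: "'a::field pi_ext"
  shows "inverse (x * y) = inverse x * inverse y"
proof -
  define N where "N = (\<lambda>z::'a pi_ext. pi_fst z * pi_fst z - pi_snd z * pi_snd z)"
  have "N (x * y) = N x * N y"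
    by (simp add: N_def times_pi_ext_def algebra_simps)
  moreover have "inverse z = PiExt (pi_fst z * inverse (N z)) (- pi_snd z * inverse (N z))" for z
    by (simp add: inverse_pi_ext_def N_def)
  ultimately show ?thesis
    by (simp add: times_pi_ext_def algebra_simps)
qed

lemma pi_ext_inverse_one: "inverse 1 = (1 :: 'a::field pi_ext)"
  by (simp add: inverse_pi_ext_def one_pi_ext_def)

lemma pi_ext_powi_mult_distrib:
  fixes x y :: "'a::field pi_ext"
  shows "(x * y) powi n = x powi n * y powi n"
  by (simp add: power_int_def pi_ext_inverse_mult power_mult_distrib)

lemma powi_Suc:
  fixes x :: "'r::{comm_ring_1, inverse}"
  assumes "x * inverse x = 1"
  shows "x powi (n + 1) = x powi n * x"
proof (cases "n \<ge> 0")
  case True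
  then show ?thesis by (simp add: power_int_def nat_add_distrib mult.commute)
next
  case False
  then have "nat (- n) = Suc (nat (- (n + 1)))" by simp
  then have "x powi n * x = inverse x ^ nat (- (n + 1)) * (x * inverse x)"
    using False by (simp add: power_int_def mult_ac)
  then show ?thesis using False assms by (simp add: power_int_def)
qed

lemma powi_add:
  fixes x :: "'r::{comm_ring_1, inverse}"
  assumes "x * inverse x = 1"
  shows "x powi (m + n) = x powi m * x powi n"
proof (induction n rule: int_induct[where k = 0])
  case base
  then show ?case by simp
next
  case (step1 i)
  then show ?case using powi_Suc[OF assms, of "m + i"] powi_Suc[OF assms, of i]
    by (simp add: algebra_simps)
next
  case (step2 i)
  have "x powi (m + (i - 1)) * x = x powi m * x powi (i - 1) * x"
    using step2 powi_Suc[OF assms, of "m + i - 1"] powi_Suc[OF assms, of "i - 1"]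
    by (simp add: algebra_simps)
  then have "x powi (m + (i - 1)) * x * inverse x = x powi m * x powi (i - 1) * x * inverse x"
    by simp
  then show ?case using assms by (simp add: mult.assoc)
qed

lemma powi_minus_unit:
  fixes x :: "'r::{comm_ring_1, inverse}"
  assumes "x * inverse x = 1"
  shows "x powi (- n) * x powi n = 1"
  using powi_add[OF assms, of "- n" n] by simp

lemma powi_sum:
  fixes x :: "'r::{comm_ring_1, inverse}"
  assumes "x * inverse x = 1"
  shows "(\<Prod>a\<in>A. x powi f a) = x powi (\<Sum>a\<in>A. f a)"
  by (induction A rule: infinite_finite_induct) (simp_all add: powi_add[OF assms])

lemma pi_ext_inverse_eqI:
  fixes x y :: "'a::field pi_ext"
  assumes "x * y = 1"
  shows "inverse x = y"
proof -
  define N where "N = (\<lambda>z::'a pi_ext. pi_fst z * pi_fst z - pi_snd z * pi_snd z)"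
  have "N x * N y = N (x * y)"
    by (simp add: N_def times_pi_ext_def algebra_simps)
  also have "\<dots> = 1" using assms by (simp add: N_def one_pi_ext_def)
  finally have "N x \<noteq> 0" by auto
  then have "x * inverse x = 1" by (intro pi_ext_inverse) (simp add: N_def)
  have "inverse x = inverse x * (x * y)" using assms by simp
  also have "\<dots> = (x * inverse x) * y" by (simp only: mult_ac)
  finally show ?thesis using \<open>x * inverse x = 1\<close> by simp
qed

lemma inverse_powi:
  fixes x :: "'a::field pi_ext"
  assumes "x * inverse x = 1"
  shows "inverse (x powi n) = x powi (- n)"
  using powi_minus_unit[OF assms, of n] by (intro pi_ext_inverse_eqI) (simp add: mult.commute)

lemma powi_powi:
  fixes x :: "'a::field pi_ext"
  assumes "x * inverse x = 1"
  shows "(x powi m) powi n = x powi (m * n)"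
proof -
  have nat: "(x powi m) ^ k = x powi (m * int k)" for m k
    by (induction k) (simp_all add: powi_add[OF assms] algebra_simps)
  show ?thesis
    by (simp add: power_int_def[of "x powi m"] nat inverse_powi[OF assms])
qed

lemma tS_unit: "tS * inverse tS = 1"
  by (simp add: inverse_tS tS_square)

lemma tS_powi_4: "tS powi (4 * n) = 1"
proof -
  have "tS powi 4 = (tS * tS) * (tS * tS)"
    by (simp add: power_int_def eval_nat_numeral mult_ac)
  then have "tS powi 4 = 1" by (simp add: tS_square)
  moreover have "(1::Qvtp) powi n = 1"
    by (simp add: power_int_def pi_ext_inverse_one)
  ultimately show ?thesis using powi_powi[OF tS_unit, of 4 n] by simp
qed

lemma tS_powi_cong:
  assumes "(m - n) mod 4 = 0"
  shows "tS powi m = tS powi n"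
proof -
  obtain k where "m = n + 4 * k" using assms by (metis add.commute diff_add_cancel mod_0_imp_dvd dvdE)
  then show ?thesis by (simp add: powi_add[OF tS_unit] tS_powi_4)
qed

text \<open>All signs become powers of \<open>t\<close>, so that the relations can be compared through exponents modulo 4.\<close>

lemma minus_one_powi: "(-1) ^ n = tS powi (2 * int n)"
  by (simp add: power_int_def nat_mult_distrib power_mult power2_eq_square tS_square)

lemma ring_map_powi:
  assumes "ring_map h" "\<And>x. h (inverse x) = inverse (h x)"
  shows "h (x powi n) = h x powi n"
  using assms by (simp add: power_int_def ring_map.power)


lemma vS_unit: "vS * inverse vS = 1"
proof -
  have "v_Qv \<noteq> 0" by (simp add: v_Qv_def Zero_fract_def eq_fract)
  then have "vR * inverse vR = 1" by (intro pi_ext_inverse) (simp add: vR_def)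
  from arg_cong[OF this, of base_emb] show ?thesis
    by (simp add: vS_def base_emb_inverse ring_map.mult ring_map.one ring_map_base_emb)
qed

lemma twist_powi_vS: "twist (vS powi d) = tS powi (- d) * vS powi d"
proof -
  have "inverse tS powi d = tS powi (- d)"
    using powi_powi[OF tS_unit, of "-1" d] by (simp add: power_int_def)
  then show ?thesis
    by (simp add: ring_map_powi[OF ring_map_twist twist_inverse] twist_vS pi_ext_powi_mult_distrib)
qed

lemma twist_powi_piS: "twist (piS powi d) = tS powi (2 * d) * piS powi d"
proof -
  have "- piS = (tS * tS) * piS" by (simp add: tS_square)
  moreover have "(tS * tS) powi d = tS powi (2 * d)"
    using powi_powi[OF tS_unit, of 2 d] by (simp add: power2_eq_square)
  ultimately show ?thesis
    by (simp add: ring_map_powi[OF ring_map_twist twist_inverse] twist_piS pi_ext_powi_mult_distrib)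
qed

text \<open>The reason why quantum integers scale: \<open>\<pi>\<^sub>i v\<^sub>i\<close> and \<open>v\<^sub>i\<^sup>-\<^sup>1\<close> are multiplied by the same factor
  \<open>t\<^sup>d\<close>, with \<open>d = d\<^sub>i\<close>.\<close>

lemma twist_quantum_diff:
  fixes d :: int
  defines "w \<equiv> vS powi d" and "q \<equiv> piS powi d"
  shows "twist ((q * w) powi l - w powi (- l)) = tS powi (d * l) * ((q * w) powi l - w powi (- l))"
proof -
  have "twist (q * w) = tS powi d * (q * w)"
    using powi_add[OF tS_unit, of "2 * d" "- d"]
    by (simp add: ring_map.mult[OF ring_map_twist] w_def q_def twist_powi_vS twist_powi_piS mult_ac)
  then have 1: "twist ((q * w) powi l) = tS powi (d * l) * (q * w) powi l"
    by (simp add: ring_map_powi[OF ring_map_twist twist_inverse] pi_ext_powi_mult_distrib[of "tS powi d"]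
        powi_powi tS_unit)
  have "twist (w powi (- l)) = tS powi (d * l) * w powi (- l)"
    using twist_powi_vS[of "d * (- l)"] by (simp add: w_def powi_powi vS_unit)
  with 1 show ?thesis
    by (simp add: ring_map.diff[OF ring_map_twist] algebra_simps)
qed

lemma twist_qint:
  "twist (qint (vS powi d) (piS powi d) n) =
     tS powi (d * (n - 1)) * qint (vS powi d) (piS powi d) n"
proof -
  define N where "N = (\<lambda>l. (piS powi d * vS powi d) powi l - (vS powi d) powi (- l))"
  have "qint (vS powi d) (piS powi d) n = N n * inverse (N 1)"
    by (simp add: qint_def N_def divide_pi_ext_def)
  moreover have "twist (N l) = tS powi (d * l) * N l" for l
    unfolding N_def by (rule twist_quantum_diff)
  ultimately show ?thesis
    using powi_add[OF tS_unit, of "d * n" "- d"]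
    by (simp add: ring_map.mult[OF ring_map_twist] twist_inverse pi_ext_inverse_mult
        inverse_powi[OF tS_unit] algebra_simps)
qed

lemma twist_qfact:
  "\<exists>e. twist (qfact (vS powi d) (piS powi d) n) = tS powi e * qfact (vS powi d) (piS powi d) n"
  by (simp add: qfact_def ring_map.prod[OF ring_map_twist] twist_qint prod.distrib powi_sum[OF tS_unit])
     blast

text \<open>The exponent is \<open>d\<close> times the sum of \<open>{n - k + 1..n}\<close> minus the sum of \<open>{1..k}\<close>, which differ by
  the shift \<open>n - k\<close> in each of the \<open>k\<close> terms.\<close>

lemma twist_qbinom:
  "twist (qbinom (vS powi d) (piS powi d) n k) =
     tS powi (d * (int k * (n - int k))) * qbinom (vS powi d) (piS powi d) n k"
proof -
  define N where "N = (\<lambda>l. (piS powi d * vS powi d) powi l - (vS powi d) powi (- l))"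
  have N: "twist (N l) = tS powi (d * l) * N l" for l
    unfolding N_def by (rule twist_quantum_diff)
  define A B where "A = {n - int k + 1..n}" and "B = {1..int k}"
  have q: "qbinom (vS powi d) (piS powi d) n k = prod N A * inverse (prod N B)"
    by (simp add: qbinom_def N_def A_def B_def divide_pi_ext_def)
  have P: "twist (prod N S) = tS powi (d * \<Sum>S) * prod N S" for S
    by (simp add: ring_map.prod[OF ring_map_twist] N prod.distrib powi_sum[OF tS_unit] sum_distrib_left)
  have "\<Sum>A = (\<Sum>l\<in>B. l + (n - int k))"
    by (rule sum.reindex_bij_witness[of _ "\<lambda>l. l + (n - int k)" "\<lambda>l. l - (n - int k)"])
      (auto simp: A_def B_def)
  then have "\<Sum>A = \<Sum>B + int k * (n - int k)"
    by (simp add: sum.distrib B_def)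
  then have "tS powi (d * \<Sum>A) * tS powi (- (d * \<Sum>B)) = tS powi (d * (int k * (n - int k)))"
    by (simp flip: powi_add[OF tS_unit]) (simp add: distrib_left)
  then show ?thesis
    by (simp add: q ring_map.mult[OF ring_map_twist] twist_inverse P pi_ext_inverse_mult
        inverse_powi[OF tS_unit] mult_ac)
qed

lemma base_emb_quantum:
  fixes d :: int
  defines "w \<equiv> vR powi d" and "q \<equiv> piR powi d"
  shows "base_emb (qint w q n) = qint (vS powi d) (piS powi d) n"
    and "base_emb (qfact w q m) = qfact (vS powi d) (piS powi d) m"
    and "base_emb (qbinom w q n k) = qbinom (vS powi d) (piS powi d) n k"
proof -
  interpret B: ring_map base_emb by (rule ring_map_base_emb)
  note p = ring_map_powi[OF ring_map_base_emb base_emb_inverse]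
  show "base_emb (qint w q n) = qint (vS powi d) (piS powi d) n" for n
    by (simp add: qint_def w_def q_def p base_emb_inverse divide_pi_ext_def flip: vS_def piS_def)
  then show "base_emb (qfact w q m) = qfact (vS powi d) (piS powi d) m"
    by (simp add: qfact_def)
  show "base_emb (qbinom w q n k) = qbinom (vS powi d) (piS powi d) n k"
    by (simp add: qbinom_def w_def q_def p base_emb_inverse divide_pi_ext_def flip: vS_def piS_def)
qed

section \<open>Algebras without unit\<close>

text \<open>The axioms are required only on the carrier, because the carriers below are sets of classes.\<close>

locale nu_algebra =
  fixes U :: "('r::comm_ring_1, 'm) nualg"
  assumes zero_closed [simp]: "nu_zero U \<in> nu_carrier U"
    and add_closed [simp]: "\<lbrakk>x \<in> nu_carrier U; y \<in> nu_carrier U\<rbrakk> \<Longrightarrow> nu_add U x y \<in> nu_carrier U"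
    and mult_closed [simp]: "\<lbrakk>x \<in> nu_carrier U; y \<in> nu_carrier U\<rbrakk> \<Longrightarrow> nu_mult U x y \<in> nu_carrier U"
    and smult_closed [simp]: "x \<in> nu_carrier U \<Longrightarrow> nu_smult U c x \<in> nu_carrier U"
    and add_assoc: "\<lbrakk>x \<in> nu_carrier U; y \<in> nu_carrier U; z \<in> nu_carrier U\<rbrakk> \<Longrightarrow>
      nu_add U (nu_add U x y) z = nu_add U x (nu_add U y z)"
    and add_comm: "\<lbrakk>x \<in> nu_carrier U; y \<in> nu_carrier U\<rbrakk> \<Longrightarrow> nu_add U x y = nu_add U y x"
    and add_zero [simp]: "x \<in> nu_carrier U \<Longrightarrow> nu_add U x (nu_zero U) = x"
    and smult_add: "\<lbrakk>x \<in> nu_carrier U; y \<in> nu_carrier U\<rbrakk> \<Longrightarrow>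
      nu_smult U c (nu_add U x y) = nu_add U (nu_smult U c x) (nu_smult U c y)"
    and add_smult: "x \<in> nu_carrier U \<Longrightarrow>
      nu_smult U (c + d) x = nu_add U (nu_smult U c x) (nu_smult U d x)"
    and mult_smult: "x \<in> nu_carrier U \<Longrightarrow> nu_smult U (c * d) x = nu_smult U c (nu_smult U d x)"
    and one_smult [simp]: "x \<in> nu_carrier U \<Longrightarrow> nu_smult U 1 x = x"
    and zero_smult [simp]: "x \<in> nu_carrier U \<Longrightarrow> nu_smult U 0 x = nu_zero U"
    and mult_assoc: "\<lbrakk>x \<in> nu_carrier U; y \<in> nu_carrier U; z \<in> nu_carrier U\<rbrakk> \<Longrightarrow>
      nu_mult U (nu_mult U x y) z = nu_mult U x (nu_mult U y z)"
    and mult_add_left: "\<lbrakk>x \<in> nu_carrier U; y \<in> nu_carrier U; z \<in> nu_carrier U\<rbrakk> \<Longrightarrow>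
      nu_mult U (nu_add U x y) z = nu_add U (nu_mult U x z) (nu_mult U y z)"
    and mult_add_right: "\<lbrakk>x \<in> nu_carrier U; y \<in> nu_carrier U; z \<in> nu_carrier U\<rbrakk> \<Longrightarrow>
      nu_mult U x (nu_add U y z) = nu_add U (nu_mult U x y) (nu_mult U x z)"
    and mult_smult_left: "\<lbrakk>x \<in> nu_carrier U; y \<in> nu_carrier U\<rbrakk> \<Longrightarrow>
      nu_mult U (nu_smult U c x) y = nu_smult U c (nu_mult U x y)"
    and mult_smult_right: "\<lbrakk>x \<in> nu_carrier U; y \<in> nu_carrier U\<rbrakk> \<Longrightarrow>
      nu_mult U x (nu_smult U c y) = nu_smult U c (nu_mult U x y)"
begin

lemma smult_zero [simp]: "nu_smult U c (nu_zero U) = nu_zero U"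
  using mult_smult[of "nu_zero U" c 0] by simp

lemma zero_add [simp]: "x \<in> nu_carrier U \<Longrightarrow> nu_add U (nu_zero U) x = x"
  by (simp add: add_comm)

lemma mult_zero [simp]: "x \<in> nu_carrier U \<Longrightarrow> nu_mult U x (nu_zero U) = nu_zero U"
  using mult_smult_right[of x "nu_zero U" 0] by simp

lemma zero_mult [simp]: "x \<in> nu_carrier U \<Longrightarrow> nu_mult U (nu_zero U) x = nu_zero U"
  using mult_smult_left[of "nu_zero U" x 0] by simp

lemma smult_commute:
  "x \<in> nu_carrier U \<Longrightarrow> nu_smult U c (nu_smult U d x) = nu_smult U d (nu_smult U c x)"
  by (metis mult_smult mult.commute)

end

locale semilinear_hom =
  U: nu_algebra U + V: nu_algebra V + \<theta>: ring_map \<theta>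
  for \<theta> :: "'r::comm_ring_1 \<Rightarrow> 's::comm_ring_1" and U :: "('r, 'm) nualg" and V :: "('s, 'n) nualg" +
  fixes f :: "'m \<Rightarrow> 'n"
  assumes closed [simp]: "x \<in> nu_carrier U \<Longrightarrow> f x \<in> nu_carrier V"
    and hom_add: "\<lbrakk>x \<in> nu_carrier U; y \<in> nu_carrier U\<rbrakk> \<Longrightarrow> f (nu_add U x y) = nu_add V (f x) (f y)"
    and hom_mult: "\<lbrakk>x \<in> nu_carrier U; y \<in> nu_carrier U\<rbrakk> \<Longrightarrow> f (nu_mult U x y) = nu_mult V (f x) (f y)"
    and hom_smult: "x \<in> nu_carrier U \<Longrightarrow> f (nu_smult U c x) = nu_smult V (\<theta> c) (f x)"
begin

lemma hom_zero [simp]: "f (nu_zero U) = nu_zero V"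
  using hom_smult[of "nu_zero U" 0] by simp

end

lemma semilinear_hom_comp:
  assumes "semilinear_hom \<theta> U V f" "semilinear_hom \<eta> V W g"
  shows "semilinear_hom (\<eta> \<circ> \<theta>) U W (g \<circ> f)"
proof -
  interpret f: semilinear_hom \<theta> U V f by fact
  interpret g: semilinear_hom \<eta> V W g by fact
  interpret ring_map "\<eta> \<circ> \<theta>" by (rule ring_map_comp) (rule g.\<theta>.ring_map_axioms f.\<theta>.ring_map_axioms)+
  show ?thesis
    by unfold_locales (simp_all add: f.hom_add f.hom_mult f.hom_smult g.hom_add g.hom_mult g.hom_smult)
qed

lemma semilinear_hom_subalg_gen:
  assumes "semilinear_hom \<theta> U V f" and G: "G \<subseteq> nu_carrier U"
    and fG: "f ` G \<subseteq> subalg_gen V B H" and AB: "\<theta> ` A \<subseteq> B"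
  shows "f ` subalg_gen U A G \<subseteq> subalg_gen V B H"
proof -
  interpret f: semilinear_hom \<theta> U V f by fact
  have "x \<in> nu_carrier U \<and> f x \<in> subalg_gen V B H" if "x \<in> subalg_gen U A G" for x
    using that
  proof induction
    case (gen g)
    then show ?case using G fG by auto
  qed (use AB in \<open>auto simp: f.hom_add f.hom_mult f.hom_smult intro: subalg_gen.intros\<close>)
  then show ?thesis by blast
qed

lemma semilinear_hom_eqI:
  assumes f: "semilinear_hom \<theta> U V f" and g: "semilinear_hom \<theta> U V g"
    and G: "G \<subseteq> nu_carrier U" and eq: "\<And>x. x \<in> G \<Longrightarrow> f x = g x"
    and x: "x \<in> subalg_gen U UNIV G"
  shows "f x = g x"
proof -
  interpret f: semilinear_hom \<theta> U V f by fact
  interpret g: semilinear_hom \<theta> U V g by fact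
  have "x \<in> nu_carrier U \<and> f x = g x"
    using x
  proof induction
    case (gen g)
    then show ?case using G eq by auto
  qed (auto simp: f.hom_add f.hom_mult f.hom_smult g.hom_add g.hom_mult g.hom_smult)
  then show ?thesis by blast
qed

section \<open>Algebras given by generators and relations\<close>

text \<open>The operations of a presented algebra are computed on classes of terms; the lemmas
  \<open>presented_alg_simps\<close> are the interface to the quotient.\<close>

definition aclass where "aclass T x = alg_rel T `` {x}"

lemma mem_aclass: "y \<in> aclass T x \<longleftrightarrow> alg_cong T x y"
  by (simp add: aclass_def alg_rel_def)

lemma aclass_eq_iff: "aclass T x = aclass T y \<longleftrightarrow> alg_cong T x y"
proof
  assume "aclass T x = aclass T y"
  then show "alg_cong T x y" by (metis mem_aclass alg_cong.refl)
next
  assume xy: "alg_cong T x y"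
  show "aclass T x = aclass T y"
  proof (rule set_eqI)
    fix z
    show "z \<in> aclass T x \<longleftrightarrow> z \<in> aclass T y"
      unfolding mem_aclass using alg_cong.trans[OF xy] alg_cong.trans[OF alg_cong.sym[OF xy]] by blast
  qed
qed

lemma aclass_UN:
  assumes "\<And>x'. alg_cong T x x' \<Longrightarrow> h x' = h x"
  shows "(\<Union>x'\<in>aclass T x. h x') = h x"
proof (rule SUP_eq_const)
  show "aclass T x \<noteq> {}" using mem_aclass alg_cong.refl by blast
qed (simp add: mem_aclass assms)

lemma presented_alg_simps:
  "nu_carrier (presented_alg T) = range (aclass T)"
  "nu_zero (presented_alg T) = aclass T Zero"
  "nu_add (presented_alg T) (aclass T x) (aclass T y) = aclass T (Add x y)"
  "nu_mult (presented_alg T) (aclass T x) (aclass T y) = aclass T (Mul x y)"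
  "nu_smult (presented_alg T) c (aclass T x) = aclass T (Smul c x)"
proof -
  show "nu_carrier (presented_alg T) = range (aclass T)"
    by (auto simp: presented_alg_def quotient_def aclass_def)
  show "nu_zero (presented_alg T) = aclass T Zero"
    by (simp add: presented_alg_def aclass_def)
  have "aclass T (Add x' y') = aclass T (Add x y)" "aclass T (Mul x' y') = aclass T (Mul x y)"
    if "alg_cong T x x'" "alg_cong T y y'" for x x' y y'
    using that by (auto simp: aclass_eq_iff intro: alg_cong.intros)
  note c = this
  show "nu_add (presented_alg T) (aclass T x) (aclass T y) = aclass T (Add x y)"
    by (simp add: presented_alg_def flip: aclass_def)
      (subst aclass_UN; (subst aclass_UN)?; auto simp: aclass_UN c alg_cong.refl)+
  show "nu_mult (presented_alg T) (aclass T x) (aclass T y) = aclass T (Mul x y)"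
    by (simp add: presented_alg_def flip: aclass_def)
      (subst aclass_UN; (subst aclass_UN)?; auto simp: aclass_UN c alg_cong.refl)+
  show "nu_smult (presented_alg T) c (aclass T x) = aclass T (Smul c x)"
    by (simp add: presented_alg_def flip: aclass_def)
      (subst aclass_UN; auto simp: aclass_eq_iff intro: alg_cong.intros)
qed

lemma nu_algebra_presented_alg: "nu_algebra (presented_alg T)"
  by unfold_locales
    (clarsimp simp: presented_alg_simps rangeI aclass_eq_iff;
      (rule alg_cong.Add_assoc alg_cong.Add_comm alg_cong.Add_Zero alg_cong.Smul_Add alg_cong.add_Smul
        alg_cong.mult_Smul alg_cong.one_Smul alg_cong.zero_Smul alg_cong.Mul_assoc alg_cong.Mul_Add_left
        alg_cong.Mul_Add_right alg_cong.Mul_Smul_left alg_cong.Mul_Smul_right)?)+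

lemma presented_alg_generated: "nu_carrier (presented_alg T) \<subseteq> subalg_gen (presented_alg T) UNIV (range (\<lambda>g. aclass T (Gen g)))"
proof -
  have "aclass T x \<in> subalg_gen (presented_alg T) UNIV (range (\<lambda>g. aclass T (Gen g)))" for x
  proof (induction x)
    case Zero
    then show ?case using subalg_gen.zero[of "presented_alg T"] by (simp add: presented_alg_simps)
  next
    case (Gen g)
    then show ?case by (auto intro: subalg_gen.gen)
  next
    case (Add x y)
    from subalg_gen.add[OF Add] show ?case by (simp add: presented_alg_simps)
  next
    case (Mul x y)
    from subalg_gen.mult[OF Mul] show ?case by (simp add: presented_alg_simps)
  next
    case (Smul c x)
    from subalg_gen.smult[OF UNIV_I Smul] show ?case by (simp add: presented_alg_simps)
  qed
  then show ?thesis by (auto simp: presented_alg_simps)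
qed

text \<open>The universal property, in a semilinear form: generators may be sent anywhere in an algebra over
  another ring, with scalars acting through a ring homomorphism, provided that the relations
  hold for the images.\<close>

primrec term_eval :: "('s, 'm) nualg \<Rightarrow> ('r \<Rightarrow> 's) \<Rightarrow> ('g \<Rightarrow> 'm) \<Rightarrow> ('g, 'r) aterm \<Rightarrow> 'm" where
  "term_eval V \<theta> \<gamma> Zero = nu_zero V"
| "term_eval V \<theta> \<gamma> (Gen g) = \<gamma> g"
| "term_eval V \<theta> \<gamma> (Add x y) = nu_add V (term_eval V \<theta> \<gamma> x) (term_eval V \<theta> \<gamma> y)"
| "term_eval V \<theta> \<gamma> (Mul x y) = nu_mult V (term_eval V \<theta> \<gamma> x) (term_eval V \<theta> \<gamma> y)"
| "term_eval V \<theta> \<gamma> (Smul c x) = nu_smult V (\<theta> c) (term_eval V \<theta> \<gamma> x)"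

definition presented_lift where
  "presented_lift V \<theta> \<gamma> X = the_elem (term_eval V \<theta> \<gamma> ` X)"

locale presented_rep = V: nu_algebra V + \<theta>: ring_map \<theta>
  for T :: "(('g, 'r::comm_ring_1) aterm \<times> ('g, 'r) aterm) set"
    and V :: "('s::comm_ring_1, 'm) nualg" and \<theta> :: "'r \<Rightarrow> 's" +
  fixes \<gamma> :: "'g \<Rightarrow> 'm"
  assumes gen_closed [simp]: "\<gamma> g \<in> nu_carrier V"
    and relation: "(x, y) \<in> T \<Longrightarrow> term_eval V \<theta> \<gamma> x = term_eval V \<theta> \<gamma> y"
begin

lemma term_eval_closed [simp]: "term_eval V \<theta> \<gamma> x \<in> nu_carrier V"
  by (induction x) simp_all

lemma term_eval_cong: "alg_cong T x y \<Longrightarrow> term_eval V \<theta> \<gamma> x = term_eval V \<theta> \<gamma> y"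
proof (induction rule: alg_cong.induct)
  case (rel x y)
  then show ?case by (rule relation)
qed (simp_all add: V.add_assoc V.smult_add V.add_smult V.mult_smult V.mult_assoc V.mult_add_left
      V.mult_add_right V.mult_smult_left V.mult_smult_right, simp add: V.add_comm)

lemma presented_lift: "presented_lift V \<theta> \<gamma> (aclass T x) = term_eval V \<theta> \<gamma> x"
proof -
  have "term_eval V \<theta> \<gamma> ` aclass T x = {term_eval V \<theta> \<gamma> x}"
    using alg_cong.refl[of T x] by (auto simp: aclass_def alg_rel_def dest: term_eval_cong)
  then show ?thesis by (simp add: presented_lift_def)
qed

lemma semilinear_hom_presented_lift:
  "semilinear_hom \<theta> (presented_alg T) V (presented_lift V \<theta> \<gamma>)"
proof -
  interpret P: nu_algebra "presented_alg T" by (rule nu_algebra_presented_alg)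
  show ?thesis
    by unfold_locales (auto simp: presented_alg_simps presented_lift)
qed

end

section \<open>Extension of scalars\<close>

text \<open>\<open>tens_mult\<close> and \<open>tens_smult\<close> are the operations on formal sums that induce those of the tensor
  product.\<close>

definition tclass where "tclass A h B M xs = tens_rel A h B M `` {xs}"

definition tens_mult where
  "tens_mult M xs ys = [(s * s', nu_mult M m m'). (s, m) \<leftarrow> xs, (s', m') \<leftarrow> ys]"

definition tens_smult where "tens_smult c xs = [(c * s, m). (s, m) \<leftarrow> xs]"

lemma tens_mult_Nil_right: "tens_mult M xs [] = []"
  by (induction xs) (auto simp: tens_mult_def)

lemma tens_mult_Nil: "tens_mult M [] ys = []"
  and tens_mult_Cons: "tens_mult M ((s, m) # xs) ys =
    map (\<lambda>(s', m'). (s * s', nu_mult M m m')) ys @ tens_mult M xs ys"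
  by (simp_all add: tens_mult_def)

lemma tens_smult_simps [simp]:
  "tens_smult c [] = []" "tens_smult c ((s, m) # xs) = (c * s, m) # tens_smult c xs"
  "tens_smult c (xs @ ys) = tens_smult c xs @ tens_smult c ys"
  by (simp_all add: tens_smult_def)

lemma tens_mult_append_left:
  "tens_mult M (xs @ xs') ys = tens_mult M xs ys @ tens_mult M xs' ys"
  by (simp add: tens_mult_def)

locale tensor = M: nu_algebra M
  for h :: "'r::comm_ring_1 \<Rightarrow> 's::comm_ring_1" and M :: "('r, 'm) nualg"
begin

definition formal :: "('s \<times> 'm) list set" where "formal = lists (UNIV \<times> nu_carrier M)"

lemma formal_simps [simp]:
  "[] \<in> formal"
  "x # xs \<in> formal \<longleftrightarrow> snd x \<in> nu_carrier M \<and> xs \<in> formal"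
  "xs @ ys \<in> formal \<longleftrightarrow> xs \<in> formal \<and> ys \<in> formal"
  by (auto simp: formal_def mem_Times_iff)

lemma formal_memD: "(s, m) \<in> set xs \<Longrightarrow> xs \<in> formal \<Longrightarrow> m \<in> nu_carrier M"
  by (auto simp: formal_def)

abbreviation rel (infix "\<approx>" 50) where "xs \<approx> ys \<equiv> tens_cong UNIV h UNIV M xs ys"

abbreviation cls where "cls \<equiv> tclass UNIV h UNIV M"

abbreviation MT where "MT \<equiv> tensor_alg UNIV h UNIV M"

lemma rel_refl: "xs \<in> formal \<Longrightarrow> xs \<approx> xs"
  unfolding formal_def by (rule tens_cong.refl)

lemma rel_add_comm: "xs \<in> formal \<Longrightarrow> ys \<in> formal \<Longrightarrow> xs @ ys \<approx> ys @ xs"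
  unfolding formal_def by (rule tens_cong.add_comm)

declare tens_cong.trans [trans]

lemma cong_sums: "xs \<approx> ys \<Longrightarrow> xs \<in> formal \<and> ys \<in> formal"
  by (induction rule: tens_cong.induct) (simp_all flip: formal_def)

lemma mem_cls: "ys \<in> cls xs \<longleftrightarrow> xs \<approx> ys"
  by (simp add: tclass_def tens_rel_def)

lemma cls_eq_iff:
  assumes "xs \<in> formal"
  shows "cls xs = cls ys \<longleftrightarrow> xs \<approx> ys"
proof
  assume "cls xs = cls ys"
  then have "ys \<approx> xs" using mem_cls[of xs xs] mem_cls[of xs ys] rel_refl[OF assms] by simp
  then show "xs \<approx> ys" by (rule tens_cong.sym)
next
  assume xy: "xs \<approx> ys"
  show "cls xs = cls ys"
  proof (rule set_eqI)
    fix zs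
    show "zs \<in> cls xs \<longleftrightarrow> zs \<in> cls ys"
      unfolding mem_cls using tens_cong.trans[OF xy] tens_cong.trans[OF tens_cong.sym[OF xy]] by blast
  qed
qed

lemma cls_UN:
  assumes "xs \<in> formal" "\<And>xs'. xs \<approx> xs' \<Longrightarrow> k xs' = k xs"
  shows "(\<Union>xs'\<in>cls xs. k xs') = k xs"
proof (rule SUP_eq_const)
  show "cls xs \<noteq> {}" using mem_cls rel_refl[OF assms(1)] by blast
qed (simp add: mem_cls assms(2))

lemma tens_mult_closed: "xs \<in> formal \<Longrightarrow> ys \<in> formal \<Longrightarrow> tens_mult M xs ys \<in> formal"
  by (fastforce simp: tens_mult_def formal_def in_lists_conv_set)

lemma tens_smult_closed: "xs \<in> formal \<Longrightarrow> tens_smult c xs \<in> formal"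
  by (auto simp: tens_smult_def formal_def in_lists_conv_set)

lemma append_cong_swap:
  assumes "xs \<in> formal" "ys \<in> formal" "zs \<in> formal" "ws \<in> formal"
  shows "(xs @ ys) @ (zs @ ws) \<approx> (xs @ zs) @ (ys @ ws)"
proof -
  have "xs @ ((ys @ zs) @ ws) \<approx> xs @ ((zs @ ys) @ ws)"
    using assms by (intro tens_cong.cong_add rel_refl rel_add_comm) auto
  then show ?thesis by simp
qed

lemma tens_smult_cong: "xs \<approx> ys \<Longrightarrow> tens_smult c xs \<approx> tens_smult c ys"
proof (induction rule: tens_cong.induct)
  case (zero m)
  then show ?case using tens_cong.zero[of m M UNIV h UNIV] by simp
next
  case (add_left s s' m)
  then show ?case
    using tens_cong.add_left[of "c * s" UNIV "c * s'" m M UNIV h] by (simp add: distrib_left)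
next
  case (balanced s a m)
  then show ?case
    using tens_cong.balanced[of "c * s" UNIV a UNIV m M h] by (simp add: mult.assoc)
qed (auto intro: rel_refl rel_add_comm tens_smult_closed tens_cong.intros simp flip: formal_def)

text \<open>On formal sums the product distributes over sums in its left argument by an equality of lists, but in
  its right argument only up to a permutation of summands. Once this is known, compatibility with the congruence can be checked on
  single tensors.\<close>

lemma tens_mult_append_right:
  assumes "xs \<in> formal" "ys \<in> formal" "zs \<in> formal"
  shows "tens_mult M xs (ys @ zs) \<approx> tens_mult M xs ys @ tens_mult M xs zs"
  using assms(1)
proof (induction xs)
  case Nil
  then show ?case by (simp add: tens_mult_def rel_refl)
next
  case (Cons x xs)
  have x: "[x] \<in> formal" "xs \<in> formal" using Cons by auto
  have *: "tens_mult M (x # xs) ws = tens_mult M [x] ws @ tens_mult M xs ws" for ws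
    using tens_mult_append_left[of M "[x]" xs ws] by simp
  have eq: "tens_mult M (x # xs) (ys @ zs) = (tens_mult M [x] ys @ tens_mult M [x] zs) @ tens_mult M xs (ys @ zs)"
    by (cases x) (simp add: tens_mult_Cons tens_mult_Nil)
  have "(tens_mult M [x] ys @ tens_mult M [x] zs) @ tens_mult M xs (ys @ zs) \<approx> (tens_mult M [x] ys @ tens_mult M [x] zs) @ (tens_mult M xs ys @ tens_mult M xs zs)"
    by (intro tens_cong.cong_add rel_refl Cons.IH x) (use assms x in \<open>simp add: tens_mult_closed\<close>)
  also have "\<dots> \<approx> (tens_mult M [x] ys @ tens_mult M xs ys) @ (tens_mult M [x] zs @ tens_mult M xs zs)"
    by (intro append_cong_swap tens_mult_closed assms x)
  finally show ?case by (simp add: eq *[of ys] *[of zs])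
qed

lemma tens_mult_cong_left:
  assumes "xs \<approx> xs'" and ys: "ys \<in> formal"
  shows "tens_mult M xs ys \<approx> tens_mult M xs' ys"
proof -
  have single: "tens_mult M xs [y] \<approx> tens_mult M xs' [y]" if y_closed: "snd y \<in> nu_carrier M" for y
  proof -
    obtain r n where y: "y = (r, n)" and n: "n \<in> nu_carrier M" using y_closed by (cases y) simp
    show ?thesis
      unfolding y using assms(1)
    proof (induction rule: tens_cong.induct)
      case (refl xs)
    note refl[folded formal_def]
      then show ?case using n by (intro rel_refl tens_mult_closed) auto
    next
      case (add_comm xs ys)
    note add_comm[folded formal_def]
      then show ?case
        using n by (simp add: tens_mult_append_left rel_add_comm tens_mult_closed)
    next
      case (zero m)
      then show ?case using n by (simp add: tens_mult_Cons tens_mult_Nil tens_cong.zero)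
    next
      case (add_left s s' m)
      then show ?case
        using n by (simp add: tens_mult_Cons tens_mult_Nil distrib_right tens_cong.add_left)
    next
      case (add_right s m m')
      then show ?case
        using n by (simp add: tens_mult_Cons tens_mult_Nil M.mult_add_left tens_cong.add_right)
    next
      case (balanced s a m)
      then show ?case
        using n tens_cong.balanced[of "s * r" UNIV a UNIV "nu_mult M m n" M h]
        by (simp add: tens_mult_Cons tens_mult_Nil M.mult_smult_left mult_ac)
    qed (auto simp: tens_mult_append_left intro: tens_cong.intros)
  qed
  have xs: "xs \<in> formal" "xs' \<in> formal" using cong_sums[OF assms(1)] by auto
  show ?thesis
    using ys
  proof (induction ys)
    case Nil
    then show ?case by (simp add: tens_mult_Nil_right rel_refl)
  next
    case (Cons y ys)
    have y: "[y] \<in> formal" "ys \<in> formal" "snd y \<in> nu_carrier M" using Cons by auto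
    have "tens_mult M xs (y # ys) \<approx> tens_mult M xs [y] @ tens_mult M xs ys"
      using tens_mult_append_right[OF xs(1) y(1,2)] by simp
    also have "\<dots> \<approx> tens_mult M xs' [y] @ tens_mult M xs' ys"
      by (intro tens_cong.cong_add single Cons.IH y)
    also have "\<dots> \<approx> tens_mult M xs' (y # ys)"
      using tens_cong.sym[OF tens_mult_append_right[OF xs(2) y(1,2)]] by simp
    finally show ?case .
  qed
qed

lemma tens_mult_cong_right:
  assumes "ys \<approx> ys'" and xs: "xs \<in> formal"
  shows "tens_mult M xs ys \<approx> tens_mult M xs ys'"
  using xs
proof (induction xs)
  case Nil
  then show ?case by (simp add: tens_mult_def rel_refl)
next
  case (Cons x xs)
  obtain r n where x: "x = (r, n)" and n: "n \<in> nu_carrier M" using Cons by (cases x) auto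
  have "tens_mult M [x] ys \<approx> tens_mult M [x] ys'"
    unfolding x using assms(1)
  proof (induction rule: tens_cong.induct)
    case (refl xs)
    note refl[folded formal_def]
    then show ?case using n by (intro rel_refl tens_mult_closed) auto
  next
    case (add_comm xs ys)
    note add_comm[folded formal_def]
    then have "tens_mult M [(r, n)] xs \<in> formal" "tens_mult M [(r, n)] ys \<in> formal"
      using n by (auto intro!: tens_mult_closed)
    then show ?case
      by (simp add: tens_mult_Cons tens_mult_Nil rel_add_comm)
  next
    case (zero m)
    then show ?case using n by (simp add: tens_mult_Cons tens_mult_Nil tens_cong.zero)
  next
    case (add_left s s' m)
    then show ?case
      using n by (simp add: tens_mult_Cons tens_mult_Nil distrib_left tens_cong.add_left)
  next
    case (add_right s m m')
    then show ?case
      using n by (simp add: tens_mult_Cons tens_mult_Nil M.mult_add_right tens_cong.add_right)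
  next
    case (balanced s a m)
    then show ?case
      using n tens_cong.balanced[of "r * s" UNIV a UNIV "nu_mult M n m" M h]
      by (simp add: tens_mult_Cons tens_mult_Nil M.mult_smult_right mult_ac)
  next
    case (sym xs ys)
    show ?case by (rule tens_cong.sym) fact
  next
    case (trans xs ys zs)
    show ?case by (rule tens_cong.trans) fact+
  next
    case (cong_add xs xs' ys ys')
    from tens_cong.cong_add[OF cong_add.IH] show ?case
      by (simp add: tens_mult_Cons tens_mult_Nil)
  qed
  from tens_cong.cong_add[OF this Cons.IH] show ?case
    using Cons.prems by (simp add: x tens_mult_Cons tens_mult_Nil)
qed

lemma tensor_alg_simps:
  "nu_carrier MT = cls ` formal"
  "nu_zero MT = cls []"
  "xs \<in> formal \<Longrightarrow> ys \<in> formal \<Longrightarrow> nu_add MT (cls xs) (cls ys) = cls (xs @ ys)"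
  "xs \<in> formal \<Longrightarrow> ys \<in> formal \<Longrightarrow> nu_mult MT (cls xs) (cls ys) = cls (tens_mult M xs ys)"
  "xs \<in> formal \<Longrightarrow> nu_smult MT c (cls xs) = cls (tens_smult c xs)"
proof -
  show "nu_carrier MT = cls ` formal"
    by (auto simp: tensor_alg_def quotient_def tclass_def formal_def)
  show "nu_zero MT = cls []"
    by (simp add: tensor_alg_def tclass_def)
  assume xs: "xs \<in> formal"
  show "nu_smult MT c (cls xs) = cls (tens_smult c xs)"
    unfolding tensor_alg_def
  proof (simp flip: tclass_def tens_smult_def, rule cls_UN[OF xs])
    fix xs' assume "xs \<approx> xs'"
    from tens_smult_cong[OF this] show "cls (tens_smult c xs') = cls (tens_smult c xs)"
      using xs by (subst eq_commute) (simp add: cls_eq_iff tens_smult_closed)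
  qed
  assume ys: "ys \<in> formal"
  have add: "cls (xs' @ ys') = cls (xs @ ys)" and mult: "cls (tens_mult M xs' ys') = cls (tens_mult M xs ys)"
    if "xs \<approx> xs'" "ys \<approx> ys'" for xs' ys'
  proof -
    show "cls (xs' @ ys') = cls (xs @ ys)"
      using tens_cong.cong_add[OF that] xs ys by (subst eq_commute) (simp add: cls_eq_iff)
    have "xs' \<in> formal" using cong_sums[OF that(1)] by simp
    then have "tens_mult M xs ys \<approx> tens_mult M xs' ys'"
      using tens_cong.trans[OF tens_mult_cong_left[OF that(1) ys] tens_mult_cong_right[OF that(2)]] by simp
    then show "cls (tens_mult M xs' ys') = cls (tens_mult M xs ys)"
      using xs ys by (subst eq_commute) (simp add: cls_eq_iff tens_mult_closed)
  qed
  have UN: "(\<Union>xs'\<in>cls xs. \<Union>ys'\<in>cls ys. k xs' ys') = k xs ys"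
    if "\<And>xs' ys'. xs \<approx> xs' \<Longrightarrow> ys \<approx> ys' \<Longrightarrow> k xs' ys' = k xs ys" for k :: "_ \<Rightarrow> _ \<Rightarrow> 'z set"
  proof -
    have inner: "(\<Union>ys'\<in>cls ys. k xs' ys') = k xs' ys" if "xs \<approx> xs'" for xs'
      by (rule cls_UN[OF ys]) (metis \<open>\<And>xs' ys'. xs \<approx> xs' \<Longrightarrow> ys \<approx> ys' \<Longrightarrow> k xs' ys' = k xs ys\<close>
          that rel_refl[OF ys])
    have "(\<Union>xs'\<in>cls xs. \<Union>ys'\<in>cls ys. k xs' ys') = (\<Union>ys'\<in>cls ys. k xs ys')"
      by (rule cls_UN[OF xs]) (metis inner that rel_refl[OF ys] rel_refl[OF xs])
    then show ?thesis using inner[OF rel_refl[OF xs]] by simp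
  qed
  show "nu_add MT (cls xs) (cls ys) = cls (xs @ ys)"
    unfolding tensor_alg_def by (simp flip: tclass_def) (rule UN, rule add)
  show "nu_mult MT (cls xs) (cls ys) = cls (tens_mult M xs ys)"
    unfolding tensor_alg_def by (simp flip: tclass_def tens_mult_def) (rule UN, rule mult)
qed

lemma tens_smult_add_cong:
  "xs \<in> formal \<Longrightarrow> tens_smult (c + d) xs \<approx> tens_smult c xs @ tens_smult d xs"
proof (induction xs)
  case (Cons x xs)
  obtain r n where x: "x = (r, n)" and n: "n \<in> nu_carrier M" using Cons by (cases x) auto
  have xs: "xs \<in> formal" using Cons by auto
  have "[((c + d) * r, n)] @ tens_smult (c + d) xs \<approx>
      ([(c * r, n)] @ [(d * r, n)]) @ (tens_smult c xs @ tens_smult d xs)"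
    using tens_cong.cong_add[OF tens_cong.add_left[of "c * r" UNIV "d * r" n M UNIV h] Cons.IH] n xs
    by (simp add: distrib_right)
  also have "\<dots> \<approx>
      ([(c * r, n)] @ tens_smult c xs) @ ([(d * r, n)] @ tens_smult d xs)"
    by (rule append_cong_swap) (use n xs in \<open>auto intro!: tens_smult_closed\<close>)
  finally show ?case by (simp add: x)
qed (simp add: rel_refl)

lemma tens_smult_zero_cong: "xs \<in> formal \<Longrightarrow> tens_smult 0 xs \<approx> []"
proof (induction xs)
  case (Cons x xs)
  then show ?case
    using tens_cong.cong_add[OF tens_cong.zero[of "snd x" M UNIV h UNIV] Cons.IH] by (cases x) auto
qed (simp add: rel_refl)

lemma tens_mult_assoc:
  assumes "xs \<in> formal" "ys \<in> formal" "zs \<in> formal"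
  shows "tens_mult M (tens_mult M xs ys) zs = tens_mult M xs (tens_mult M ys zs)"
proof -
  have single: "tens_mult M (tens_mult M [x] ys) zs = tens_mult M [x] (tens_mult M ys zs)"
    if "snd x \<in> nu_carrier M" for x
    using assms(2)
  proof (induction ys)
    case (Cons y ys)
    have "tens_mult M [x] (y # ys) = tens_mult M [x] [y] @ tens_mult M [x] ys"
      by (cases x) (simp add: tens_mult_Cons tens_mult_Nil)
    moreover have "tens_mult M (tens_mult M [x] [y]) zs = tens_mult M [x] (tens_mult M [y] zs)"
      using that Cons.prems assms(3)
      by (cases x; cases y) (auto simp: tens_mult_Cons tens_mult_Nil M.mult_assoc mult.assoc dest: formal_memD)
    moreover have "tens_mult M (y # ys) zs = tens_mult M [y] zs @ tens_mult M ys zs"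
      by (cases y) (simp add: tens_mult_Cons tens_mult_Nil)
    moreover have "tens_mult M [x] (us @ ws) = tens_mult M [x] us @ tens_mult M [x] ws" for us ws
      by (cases x) (simp add: tens_mult_Cons tens_mult_Nil)
    ultimately show ?case using Cons by (simp add: tens_mult_append_left)
  qed (simp add: tens_mult_def)
  show ?thesis
    using assms(1)
  proof (induction xs)
    case (Cons x xs)
    have "tens_mult M (x # xs) ws = tens_mult M [x] ws @ tens_mult M xs ws" for ws
      using tens_mult_append_left[of M "[x]" xs ws] by simp
    with Cons single[of x] show ?case by (auto simp: tens_mult_append_left)
  qed (simp add: tens_mult_def)
qed

lemma tens_smult_mult_left:
  fixes c :: 's
  shows "tens_mult M (tens_smult c xs) ys = tens_smult c (tens_mult M xs ys)"
  by (induction xs) (auto simp: tens_mult_Cons tens_mult_Nil tens_smult_def mult.assoc split: prod.splits)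

lemma tens_smult_mult_right:
  fixes c :: 's
  shows "tens_mult M xs (tens_smult c ys) = tens_smult c (tens_mult M xs ys)"
  by (induction xs) (auto simp: tens_mult_Cons tens_mult_Nil tens_smult_def mult_ac split: prod.splits)

lemma tens_smult_one: "tens_smult (1 :: 's) xs = xs"
  by (simp add: tens_smult_def)

lemma tens_smult_smult: "tens_smult (c * d :: 's) xs = tens_smult c (tens_smult d xs)"
  by (simp add: tens_smult_def mult.assoc comp_def case_prod_beta)

lemma nu_algebra_tensor_alg: "nu_algebra MT"
proof
  note closed = tens_mult_closed tens_smult_closed
  show "nu_add MT x y = nu_add MT y x" if "x \<in> nu_carrier MT" "y \<in> nu_carrier MT" for x y
    using that by (clarsimp simp: tensor_alg_simps cls_eq_iff rel_add_comm)
  show "nu_smult MT (c + d) x = nu_add MT (nu_smult MT c x) (nu_smult MT d x)"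
    if "x \<in> nu_carrier MT" for c d x
    using that by (clarsimp simp: tensor_alg_simps cls_eq_iff closed tens_smult_add_cong)
  show "nu_smult MT 1 x = x" "nu_smult MT 0 x = nu_zero MT" if "x \<in> nu_carrier MT" for x
    using that by (clarsimp simp: tensor_alg_simps cls_eq_iff closed tens_smult_zero_cong tens_smult_one)+
  show "nu_smult MT (c * d) x = nu_smult MT c (nu_smult MT d x)" if "x \<in> nu_carrier MT" for c d x
    using that by (clarsimp simp: tensor_alg_simps closed tens_smult_smult)
  show "nu_mult MT x (nu_add MT y z) = nu_add MT (nu_mult MT x y) (nu_mult MT x z)"
    if "x \<in> nu_carrier MT" "y \<in> nu_carrier MT" "z \<in> nu_carrier MT" for x y z
    using that by (clarsimp simp: tensor_alg_simps closed cls_eq_iff tens_mult_append_right)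
  show "nu_mult MT (nu_mult MT x y) z = nu_mult MT x (nu_mult MT y z)"
    if "x \<in> nu_carrier MT" "y \<in> nu_carrier MT" "z \<in> nu_carrier MT" for x y z
    using that by (clarsimp simp: tensor_alg_simps closed tens_mult_assoc)
qed (clarsimp simp: tensor_alg_simps tens_mult_closed tens_smult_closed tens_mult_append_left
    tens_smult_mult_left tens_smult_mult_right)+


lemma cls_Cons:
  assumes "m \<in> nu_carrier M" "xs \<in> formal"
  shows "cls ((s, m) # xs) = nu_add MT (nu_smult MT s (cls [(1, m)])) (cls xs)"
  using assms by (simp add: tensor_alg_simps tens_smult_closed)

lemma semilinear_hom_tens_unit:
  assumes "ring_map h"
  shows "semilinear_hom h M MT (\<lambda>m. cls [(1, m)])"
proof -
  interpret MT: nu_algebra MT by (rule nu_algebra_tensor_alg)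
  interpret h: ring_map h by fact
  show ?thesis
  proof
    fix x y assume xy: "x \<in> nu_carrier M" "y \<in> nu_carrier M"
    show "cls [(1, nu_add M x y)] = nu_add MT (cls [(1, x)]) (cls [(1, y)])"
      using xy by (simp add: tensor_alg_simps cls_eq_iff tens_cong.add_right)
    show "cls [(1, nu_mult M x y)] = nu_mult MT (cls [(1, x)]) (cls [(1, y)])"
      using xy by (simp add: tensor_alg_simps tens_mult_Cons tens_mult_Nil)
  next
    fix x c assume x: "x \<in> nu_carrier M"
    show "cls [(1, nu_smult M c x)] = nu_smult MT (h c) (cls [(1, x)])"
      using x tens_cong.sym[OF tens_cong.balanced[of 1 UNIV c UNIV x M h]]
      by (simp add: tensor_alg_simps cls_eq_iff)
  qed (simp add: tensor_alg_simps)
qed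

text \<open>If \<open>M\<close> contains the \<open>A\<close>-form generated by \<open>G\<close>, then sums of tensors of elements of \<open>B\<close> with elements of this form
  lie in the \<open>B\<close>-subalgebra generated by the \<open>1 \<otimes> g\<close>. With \<open>A\<close> and \<open>B\<close> the whole rings this says that
  extension of scalars does not need new generators; with integral coefficients it describes the integral
  form.\<close>

lemma cls_in_subalg_gen:
  assumes h: "ring_map h" and G: "G \<subseteq> nu_carrier M" and AB: "h ` A \<subseteq> B"
    and xs: "xs \<in> lists (B \<times> subalg_gen M A G)"
  shows "cls xs \<in> subalg_gen MT B ((\<lambda>m. cls [(1, m)]) ` G)"
proof -
  have sub: "subalg_gen M A G \<subseteq> nu_carrier M"
  proof
    fix x assume "x \<in> subalg_gen M A G"
    then show "x \<in> nu_carrier M" by induction (use G in auto)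
  qed
  have unit: "(\<lambda>m. cls [(1, m)]) ` subalg_gen M A G \<subseteq> subalg_gen MT B ((\<lambda>m. cls [(1, m)]) ` G)"
    by (rule semilinear_hom_subalg_gen[OF semilinear_hom_tens_unit[OF h] G _ AB])
      (auto intro: subalg_gen.gen)
  have "xs \<in> formal" using xs sub by (auto simp: formal_def)
  with xs show ?thesis
  proof (induction xs rule: list.induct)
    case Nil
    then show ?case using subalg_gen.zero[of MT] by (simp add: tensor_alg_simps)
  next
    case (Cons x xs)
    obtain s m where x: "x = (s, m)" by force
    have sm: "s \<in> B" "m \<in> subalg_gen M A G" "m \<in> nu_carrier M" "xs \<in> formal"
      "xs \<in> lists (B \<times> subalg_gen M A G)"
      using Cons.prems by (auto simp: x)
    have "cls [(1, m)] \<in> subalg_gen MT B ((\<lambda>m. cls [(1, m)]) ` G)"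
      using unit sm(2) by blast
    then show ?case
      unfolding x cls_Cons[OF sm(3,4)] using Cons.IH sm by (intro subalg_gen.add subalg_gen.smult)
  qed
qed

end

text \<open>The universal property of extension of scalars along \<open>h\<close>: a \<open>\<sigma> \<circ> h\<close>-semilinear homomorphism \<open>f\<close> out of \<open>M\<close>
  extends to the \<sigma>-semilinear map \<open>s \<otimes> m \<mapsto> \<sigma>(s) f(m)\<close>.\<close>

definition tens_eval :: "('t, 'n) nualg \<Rightarrow> ('s \<Rightarrow> 't) \<Rightarrow> ('m \<Rightarrow> 'n) \<Rightarrow> ('s \<times> 'm) list \<Rightarrow> 'n" where
  "tens_eval V \<sigma> f xs = foldr (\<lambda>(s, m) a. nu_add V (nu_smult V (\<sigma> s) (f m)) a) xs (nu_zero V)"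

definition tens_lift where
  "tens_lift V \<sigma> f X = the_elem (tens_eval V \<sigma> f ` X)"

lemma tens_eval_simps [simp]:
  "tens_eval V \<sigma> f [] = nu_zero V"
  "tens_eval V \<sigma> f ((s, m) # xs) = nu_add V (nu_smult V (\<sigma> s) (f m)) (tens_eval V \<sigma> f xs)"
  by (simp_all add: tens_eval_def)

locale tensor_rep = tensor h M + f: semilinear_hom "\<sigma> \<circ> h" M V f + \<sigma>: ring_map \<sigma>
  for h :: "'r::comm_ring_1 \<Rightarrow> 's::comm_ring_1" and M :: "('r, 'm) nualg"
    and \<sigma> :: "'s \<Rightarrow> 't::comm_ring_1" and V :: "('t, 'n) nualg" and f
begin

lemma tens_eval_closed [simp]: "xs \<in> formal \<Longrightarrow> tens_eval V \<sigma> f xs \<in> nu_carrier V"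
  by (induction xs) auto

lemma tens_eval_append:
  "xs \<in> formal \<Longrightarrow> ys \<in> formal \<Longrightarrow>
    tens_eval V \<sigma> f (xs @ ys) = nu_add V (tens_eval V \<sigma> f xs) (tens_eval V \<sigma> f ys)"
  by (induction xs) (auto simp: f.V.add_assoc)

lemma tens_eval_smult:
  "xs \<in> formal \<Longrightarrow> tens_eval V \<sigma> f (tens_smult c xs) = nu_smult V (\<sigma> c) (tens_eval V \<sigma> f xs)"
  by (induction xs) (auto simp: f.V.smult_add f.V.mult_smult)

lemma tens_eval_mult:
  assumes "xs \<in> formal" "ys \<in> formal"
  shows "tens_eval V \<sigma> f (tens_mult M xs ys) = nu_mult V (tens_eval V \<sigma> f xs) (tens_eval V \<sigma> f ys)"
  using assms(1)
proof (induction xs)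
  case (Cons x xs)
  obtain r n where x: "x = (r, n)" and n: "n \<in> nu_carrier M" using Cons by (cases x) auto
  have "tens_eval V \<sigma> f (tens_mult M [x] ys) =
      nu_mult V (nu_smult V (\<sigma> r) (f n)) (tens_eval V \<sigma> f ys)"
    using assms(2)
  proof (induction ys)
    case (Cons y ys)
    then show ?case
      using n by (cases y) (auto simp: x tens_mult_Cons tens_mult_Nil f.hom_mult f.V.mult_smult f.V.smult_commute[of _ "\<sigma> r"]
          f.V.mult_smult_left f.V.mult_smult_right f.V.mult_add_right)
  qed (use n in \<open>simp add: tens_mult_def x\<close>)
  moreover have "tens_eval V \<sigma> f (tens_mult M (x # xs) ys) =
      nu_add V (tens_eval V \<sigma> f (tens_mult M [x] ys)) (tens_eval V \<sigma> f (tens_mult M xs ys))"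
    using tens_mult_append_left[of M "[x]" xs ys] tens_eval_append[of "tens_mult M [x] ys" "tens_mult M xs ys"]
      Cons assms(2) by (simp add: tens_mult_closed)
  ultimately show ?case
    using Cons n assms(2) by (simp add: x f.V.mult_add_left)
qed (simp add: tens_mult_def assms)

lemma tens_eval_cong: "xs \<approx> ys \<Longrightarrow> tens_eval V \<sigma> f xs = tens_eval V \<sigma> f ys"
proof (induction rule: tens_cong.induct)
  case (cong_add xs xs' ys ys')
  then show ?case using cong_sums by (simp add: tens_eval_append)
next
  case (add_comm xs ys)
    note add_comm[folded formal_def]
  then show ?case by (simp add: tens_eval_append f.V.add_comm)
qed (auto simp: f.V.add_smult f.V.smult_add f.V.mult_smult f.hom_add f.hom_smult)

lemma tens_lift: "xs \<in> formal \<Longrightarrow> tens_lift V \<sigma> f (cls xs) = tens_eval V \<sigma> f xs"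
proof -
  assume "xs \<in> formal"
  then have "tens_eval V \<sigma> f ` cls xs = {tens_eval V \<sigma> f xs}"
    using rel_refl[of xs] by (auto simp: tclass_def tens_rel_def dest: tens_eval_cong)
  then show ?thesis by (simp add: tens_lift_def)
qed

lemma semilinear_hom_tens_lift: "semilinear_hom \<sigma> MT V (tens_lift V \<sigma> f)"
proof -
  interpret MT: nu_algebra MT by (rule nu_algebra_tensor_alg)
  show ?thesis
    by unfold_locales
      (auto simp: tensor_alg_simps tens_lift tens_mult_closed tens_smult_closed tens_eval_append
        tens_eval_mult tens_eval_smult)
qed

end

section \<open>Exponents along the root lattice\<close>

lemma root_emb_add: "root_emb D (\<mu> + \<nu>) = root_emb D \<mu> + root_emb D \<nu>"
  by (simp add: root_emb_def lookup_add zsmult_add sum.distrib)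

lemma root_emb_frag_of: "root_emb D (frag_of i) = simple_root D i"
proof -
  have "root_emb D (frag_of i) = (\<Sum>j\<in>UNIV. if j = i then simple_root D j else 0)"
    unfolding root_emb_def by (rule sum.cong) (auto simp: lookup_single when_def)
  then show ?thesis by simp
qed

locale root_datum =
  fixes D :: "('i::{finite, linorder}, 'y::ab_group_add, 'x::ab_group_add) super_datum"
    and C :: "'x set"
  assumes datum: "super_root_datum D" and transversal: "transversal D C"
begin

text \<open>Linear independence of the simple roots makes the decomposition of a weight into a root-lattice part and a
  coset representative unique, so that the definite description in \<open>phidot\<close> is meaningful.\<close>

lemma root_emb_eq_0:
  assumes "root_emb D \<mu> = 0"
  shows "\<mu> = 0"
proof (rule poly_mapping_eqI)
  fix i
  have inj: "inj (simple_root D)" and ind: "zmod.independent (range (simple_root D))"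
    using datum by (auto simp: super_root_datum_def)
  let ?u = "\<lambda>v. Poly_Mapping.lookup \<mu> (inv (simple_root D) v)"
  have "(\<Sum>v\<in>range (simple_root D). zsmult (?u v) v) = 0"
    using assms inj by (simp add: sum.reindex root_emb_def)
  from zmod.independentD[OF ind _ _ this, of "simple_root D i"] inj
  show "Poly_Mapping.lookup \<mu> i = Poly_Mapping.lookup 0 i" by simp
qed

lemma inj_root_emb: "inj (root_emb D)"
proof
  fix \<mu> \<nu> assume "root_emb D \<mu> = root_emb D \<nu>"
  then have "root_emb D (\<mu> - \<nu>) = 0"
    using root_emb_add[of D "\<mu> - \<nu>" \<nu>] by simp
  then show "\<mu> = \<nu>" using root_emb_eq_0 by force
qed

lemma ex1_root_part: "\<exists>!\<mu>. \<exists>c\<in>C. \<zeta> = root_emb D \<mu> + c"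
proof -
  obtain c \<mu> where c: "c \<in> C" "\<zeta> - c = root_emb D \<mu>"
    using transversal unfolding transversal_def by blast
  show ?thesis
  proof (rule ex1I[of _ \<mu>])
    show "\<exists>c\<in>C. \<zeta> = root_emb D \<mu> + c"
      using c by (intro bexI[of _ c]) (auto simp: algebra_simps)
    fix \<nu> assume "\<exists>c\<in>C. \<zeta> = root_emb D \<nu> + c"
    then obtain c' where c': "c' \<in> C" "\<zeta> = root_emb D \<nu> + c'" by blast
    then have "\<zeta> - c' \<in> range (root_emb D)" "\<zeta> - c \<in> range (root_emb D)" using c by auto
    then have "c = c'" using c'(1) c(1) transversal unfolding transversal_def by blast
    then show "\<nu> = \<mu>" using c' c inj_root_emb by (auto dest: injD)
  qed
qed

lemma phi_frag_of_add:
  "phi D (frag_of i) (\<mu> + frag_of j) = phi D (frag_of i) \<mu> + phi0 D i j"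
proof -
  have "phi D (frag_of i) \<nu> = (\<Sum>k\<in>UNIV. Poly_Mapping.lookup \<nu> k * phi0 D i k)" for \<nu>
  proof -
    have "phi D (frag_of i) \<nu> =
        (\<Sum>l\<in>UNIV. if l = i then (\<Sum>k\<in>UNIV. Poly_Mapping.lookup \<nu> k * phi0 D i k) else 0)"
      unfolding phi_def by (rule sum.cong) (auto simp: lookup_single when_def)
    then show ?thesis by simp
  qed
  moreover have "(\<Sum>k\<in>UNIV. Poly_Mapping.lookup (frag_of j) k * phi0 D i k) = phi0 D i j"
  proof -
    have "(\<Sum>k\<in>UNIV. Poly_Mapping.lookup (frag_of j) k * phi0 D i k) =
        (\<Sum>k\<in>UNIV. if k = j then phi0 D i k else 0)"
      by (rule sum.cong) (auto simp: lookup_single when_def)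
    then show ?thesis by simp
  qed
  ultimately show ?thesis by (simp add: lookup_add distrib_right sum.distrib)
qed

text \<open>Adding a root changes only the root-lattice part of a weight, and \<open>phi\<close> is additive in it.\<close>

lemma phidot_add_root:
  "phidot D C (frag_of i) (\<zeta> + simple_root D j) = phidot D C (frag_of i) \<zeta> + phi0 D i j"
proof -
  let ?P = "\<lambda>\<zeta> \<mu>. \<exists>c\<in>C. \<zeta> = root_emb D \<mu> + c"
  obtain \<mu> where \<mu>: "?P \<zeta> \<mu>" using ex1_root_part by blast
  then have "?P (\<zeta> + simple_root D j) (\<mu> + frag_of j)"
    by (auto simp: root_emb_add root_emb_frag_of algebra_simps)
  from the1_equality[OF ex1_root_part this] the1_equality[OF ex1_root_part \<mu>]
  have "(THE \<mu>. ?P (\<zeta> + simple_root D j) \<mu>) = \<mu> + frag_of j" "(THE \<mu>. ?P \<zeta> \<mu>) = \<mu>" .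
  then show ?thesis by (simp add: phidot_def phi_frag_of_add)
qed

lemma pairing_add_root:
  "pairing D (simple_coroot D i) (\<zeta> + simple_root D j) =
    pairing D (simple_coroot D i) \<zeta> + cartan D i j"
  using datum unfolding super_root_datum_def perfect_pairing_def biadditive_def
  by (simp add: additive.add)

fun twist_exp :: "'i letter \<Rightarrow> 'x \<Rightarrow> int" where
  "twist_exp (E i) \<zeta> = dd D i * pairing D (simple_coroot D i) \<zeta> - phidot D C (frag_of i) \<zeta>"
| "twist_exp (F i) \<zeta> = phidot D C (frag_of i) \<zeta>"

text \<open>\<open>exp_shift x y\<close> is the change of the exponent of the letter \<open>x\<close> when the weight moves by the weight of
  \<open>y\<close>. It does not depend on the weight (\<open>twist_exp_add_wt\<close>).\<close>

fun exp_shift :: "'i letter \<Rightarrow> 'i letter \<Rightarrow> int" where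
  "exp_shift (E i) (E j) = dd D i * cartan D i j - phi0 D i j"
| "exp_shift (E i) (F j) = phi0 D i j - dd D i * cartan D i j"
| "exp_shift (F i) (E j) = phi0 D i j"
| "exp_shift (F i) (F j) = - phi0 D i j"

lemma twist_exp_add_wt: "twist_exp x (\<zeta> + wt D y) = twist_exp x \<zeta> + exp_shift x y"
proof -
  have "pairing D (simple_coroot D i) (\<zeta> - simple_root D j) =
      pairing D (simple_coroot D i) \<zeta> - cartan D i j"
    "phidot D C (frag_of i) (\<zeta> - simple_root D j) = phidot D C (frag_of i) \<zeta> - phi0 D i j" for i j
    using pairing_add_root[of i "\<zeta> - simple_root D j" j] phidot_add_root[of i "\<zeta> - simple_root D j" j]
    by simp_all
  then show ?thesis
    by (cases x; cases y) (simp_all add: pairing_add_root phidot_add_root distrib_left right_diff_distrib)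
qed

text \<open>The exponent of \<open>t\<close> acquired by the monomial \<open>umono D xs \<zeta>\<close>.\<close>

fun word_exp :: "'i letter list \<Rightarrow> 'x \<Rightarrow> int" where
  "word_exp [] \<zeta> = 0"
| "word_exp (x # xs) \<zeta> = twist_exp x (\<zeta> + sum_list (map (wt D) xs)) + word_exp xs \<zeta>"

lemma word_exp_append:
  "word_exp (xs @ ys) \<zeta> = word_exp xs (\<zeta> + sum_list (map (wt D) ys)) + word_exp ys \<zeta>"
  by (induction xs) (simp_all add: add_ac)

lemma word_exp_swap:
  "word_exp (xs @ [x, y] @ ys) \<zeta> =
    word_exp (xs @ [y, x] @ ys) \<zeta> + exp_shift x y - exp_shift y x"
proof -
  define \<eta> where "\<eta> = \<zeta> + sum_list (map (wt D) ys)"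
  have "word_exp [x, y] \<eta> = word_exp [y, x] \<eta> + exp_shift x y - exp_shift y x"
    by (simp add: twist_exp_add_wt)
  then show ?thesis
    unfolding word_exp_append \<eta>_def by (simp add: add_ac)
qed

text \<open>Moving the letter \<open>y\<close> to the end of the word takes \<open>k\<close> interchanges with a neighbouring \<open>x\<close>.\<close>

lemma word_exp_serre:
  "word_exp (replicate m x @ [y] @ replicate k x) \<zeta> =
    word_exp (replicate (m + k) x @ [y]) \<zeta> + int k * (exp_shift y x - exp_shift x y)"
proof (induction k arbitrary: m)
  case (Suc k)
  have "word_exp (replicate m x @ [y] @ replicate (Suc k) x) \<zeta> =
      word_exp (replicate (Suc m) x @ [y] @ replicate k x) \<zeta> + exp_shift y x - exp_shift x y"
    using word_exp_swap[of "replicate m x" y x "replicate k x" \<zeta>]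
    by (simp flip: replicate_append_same)
  also note Suc.IH[of "Suc m"]
  finally show ?case by (simp add: algebra_simps)
qed simp

lemma cartan_datum: "super_cartan_datum D"
  using datum by (simp add: super_root_datum_def)

lemma dd_pos: "dd D i > 0"
  using cartan_datum by (simp add: super_cartan_datum_def)

lemma dd_par: "even (int (par D i) - dd D i)"
proof -
  have "dd D i mod 2 = int (par D i) mod 2"
    using cartan_datum by (auto simp: super_cartan_datum_def)
  then show ?thesis by presburger
qed

lemma dd_cartan: "dd D i * cartan D i j = sq D i j"
proof -
  have e: "sq D i i = 2 * dd D i"
    using cartan_datum by (auto simp: super_cartan_datum_def dd_def)
  moreover have "sq D i i dvd 2 * sq D i j"
    using cartan_datum by (cases "i = j") (auto simp: super_cartan_datum_def)
  ultimately have "2 * dd D i * cartan D i j = 2 * sq D i j"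
    by (simp add: cartan_def)
  then show ?thesis by simp
qed

lemma dd_cartan_sym: "dd D i * cartan D i j = dd D j * cartan D j i"
proof -
  have "sq D i j = sq D j i"
    using cartan_datum unfolding super_cartan_datum_def sq_def by metis
  then show ?thesis by (simp add: dd_cartan)
qed

lemma cartan_same: "cartan D i i = 2"
proof -
  have "sq D i i = 2 * dd D i"
    using cartan_datum by (auto simp: super_cartan_datum_def dd_def)
  then show ?thesis using dd_cartan[of i i] dd_pos[of i] by simp
qed

text \<open>For odd \<open>i\<close> the Cartan integer is even, and for even \<open>i\<close> the factor \<open>d\<^sub>i\<close> is even because it has the
  parity of \<open>i\<close>.\<close>

lemma dd_cartan_even: "even (dd D i * cartan D i j)"
proof (cases "i \<in> sodd D")
  case True
  then show ?thesis using cartan_datum by (simp add: super_cartan_datum_def)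
next
  case False
  then show ?thesis using dd_par[of i] by (simp add: par_def)
qed

text \<open>The congruence modulo 4 behind all relations. For \<open>j < i\<close> it is an equality; exchanging \<open>i\<close> and \<open>j\<close> negates
  the left side, which is harmless because \<open>2 d\<^sub>i a\<^sub>i\<^sub>j\<close> is divisible by 4; and for
  \<open>i = j\<close> it says that \<open>d\<^sub>i\<close> and \<open>p(i)\<close> have the same parity.\<close>

lemma phi0_antisym:
  "\<exists>m. phi0 D i j - phi0 D j i = dd D i * cartan D i j + 2 * (int (par D i) * int (par D j)) + 4 * m"
proof -
  obtain r where r: "dd D i * cartan D i j = 2 * r" using dd_cartan_even by blast
  obtain s where s: "int (par D i) - dd D i = 2 * s" using dd_par by blast
  consider "j < i" | "i < j" | "i = j" by fastforce
  then show ?thesis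
  proof cases
    case 1
    then have "\<not> i < j" "j \<noteq> i" by auto
    with 1 show ?thesis by (intro exI[of _ 0]) (simp add: phi0_def)
  next
    case 2
    then have "\<not> j < i" "j \<noteq> i" by auto
    with 2 show ?thesis
      using r dd_cartan_sym[of i j]
      by (intro exI[of _ "- r - int (par D i) * int (par D j)"]) (simp add: phi0_def algebra_simps)
  next
    case 3
    show ?thesis
      using s 3 by (intro exI[of _ "s - int (par D i)"]) (auto simp: cartan_same par_def split: if_splits)
  qed
qed

section \<open>The twisted generators\<close>

abbreviation Ut where "Ut \<equiv> Udot_t D"

sublocale Udot: nu_algebra "Udot D"
  unfolding Udot_def by (rule nu_algebra_presented_alg)

sublocale tensor base_emb "Udot D" ..

sublocale Ut: nu_algebra Ut
  unfolding Udot_t_def by (rule nu_algebra_tensor_alg)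

text \<open>\<open>unit m\<close> is \<open>1 \<otimes> m\<close>, and \<open>ext x\<close> is \<open>1 \<otimes> [x]\<close> for the class of a term \<open>x\<close>.\<close>

definition unit where "unit m = cls [(1, m)]"

definition ext where "ext x = unit (uclass D x)"

lemma uclass_eq: "uclass D x = aclass (udot_rels D) x"
  by (simp add: uclass_def aclass_def)

lemma uclass_closed [simp]: "uclass D x \<in> nu_carrier (Udot D)"
  by (simp add: Udot_def uclass_eq presented_alg_simps)

lemma ugen_t_eq: "ugen_t D g = ext (Gen g)"
  by (simp add: ugen_t_def ext_def unit_def tclass_def)

lemma semilinear_hom_unit: "semilinear_hom base_emb (Udot D) Ut unit"
  using semilinear_hom_tens_unit[OF ring_map_base_emb] unfolding unit_def[abs_def] Udot_t_def .

sublocale unit: semilinear_hom base_emb "Udot D" Ut unit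
  by (rule semilinear_hom_unit)

lemma ext_simps:
  "ext x \<in> nu_carrier Ut"
  "ext Zero = nu_zero Ut"
  "ext (Add x y) = nu_add Ut (ext x) (ext y)"
  "ext (Mul x y) = nu_mult Ut (ext x) (ext y)"
  "ext (Smul c x) = nu_smult Ut (base_emb c) (ext x)"
proof -
  note s = presented_alg_simps[of "udot_rels D", folded Udot_def uclass_eq, symmetric]
  show "ext x \<in> nu_carrier Ut" by (simp add: ext_def)
  show "ext Zero = nu_zero Ut" "ext (Add x y) = nu_add Ut (ext x) (ext y)"
    "ext (Mul x y) = nu_mult Ut (ext x) (ext y)"
    "ext (Smul c x) = nu_smult Ut (base_emb c) (ext x)"
    by (simp_all add: ext_def s unit.hom_add unit.hom_mult unit.hom_smult del: unit.hom_zero flip: unit.hom_zero)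
qed

fun gen_exp :: "('i, 'x) ugen \<Rightarrow> int" where
  "gen_exp (Idem \<zeta>) = 0"
| "gen_exp (Chev x \<zeta>) = twist_exp x \<zeta>"

definition twist_gen where
  "twist_gen g = nu_smult Ut (tS powi gen_exp g) (ext (Gen g))"

abbreviation twist_eval where
  "twist_eval \<equiv> term_eval Ut (twist \<circ> base_emb) twist_gen"

text \<open>Evaluating the term \<open>x\<close> at the twisted generators multiplies it by \<open>t\<^sup>e\<close>. Only \<open>e\<close> modulo 4 matters
  (\<open>scaled_cong\<close>), and both sides of every defining relation will be scaled by a common exponent.\<close>

definition scaled where
  "scaled x e \<longleftrightarrow> twist_eval x = nu_smult Ut (tS powi e) (ext x)"

lemma scaled_Gen: "scaled (Gen g) (gen_exp g)"
  by (simp add: scaled_def twist_gen_def)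

lemma scaled_Zero: "scaled Zero e"
  by (simp add: scaled_def ext_simps)

lemma scaled_Add: "scaled x e \<Longrightarrow> scaled y e \<Longrightarrow> scaled (Add x y) e"
  by (simp add: scaled_def ext_simps Ut.smult_add)

lemma scaled_Mul: "scaled x a \<Longrightarrow> scaled y b \<Longrightarrow> scaled (Mul x y) (a + b)"
  by (simp add: scaled_def ext_simps Ut.mult_smult_left Ut.mult_smult_right Ut.mult_smult
      Ut.smult_commute[of _ "tS powi a"] powi_add[OF tS_unit])

lemma scaled_Smul:
  assumes "twist (base_emb c) = tS powi a * base_emb c" "scaled x b"
  shows "scaled (Smul c x) (a + b)"
  using assms by (simp add: scaled_def ext_simps powi_add[OF tS_unit] flip: Ut.mult_smult)
    (simp add: mult_ac)

lemma scaled_cong: "scaled x e \<Longrightarrow> 4 dvd e - e' \<Longrightarrow> scaled x e'"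
  using tS_powi_cong[of e e'] by (simp add: scaled_def)

lemma scaled_umono: "scaled (umono D xs \<zeta>) (word_exp xs \<zeta>)"
proof (induction xs)
  case Nil
  then show ?case using scaled_Gen[of "Idem \<zeta>"] by simp
next
  case (Cons x xs)
  from scaled_Mul[OF scaled_Gen Cons] show ?case by (metis umono.simps(2) gen_exp.simps(2) word_exp.simps(2))
qed

lemma base_emb_at:
  "base_emb (qint (v_at D i) (pi_at D i) n) = qint (vS powi dd D i) (piS powi dd D i) n"
  "base_emb (qfact (v_at D i) (pi_at D i) m) = qfact (vS powi dd D i) (piS powi dd D i) m"
  "base_emb (qbinom (v_at D i) (pi_at D i) n k) = qbinom (vS powi dd D i) (piS powi dd D i) n k"
  by (simp_all add: v_at_def pi_at_def base_emb_quantum)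

lemma twist_sign: "twist (piS ^ n) = tS powi (2 * int n) * piS ^ n"
proof -
  have "(- piS) ^ n = (-1) ^ n * piS ^ n" by (metis power_mult_distrib mult_minus1)
  then show ?thesis
    by (simp add: ring_map.power[OF ring_map_twist] twist_piS minus_one_powi)
qed

text \<open>The terms \<open>E\<^sub>i F\<^sub>j\<close> and \<open>F\<^sub>j E\<^sub>i\<close> differ in exponent by \<open>\<phi>(i,j) - \<phi>(j,i) - d\<^sub>i a\<^sub>i\<^sub>j\<close>, which has to be matched
  with the sign that \<sigma> gives to the coefficient \<open>\<pi>\<close> to the power \<open>p(i) p(j)\<close>.\<close>

lemma scaled_comm_left:
  "scaled (Add (umono D [E i, F j] \<zeta>) (Smul (- (piR ^ (par D i * par D j))) (umono D [F j, E i] \<zeta>)))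
     (word_exp [E i, F j] \<zeta>)"
proof (rule scaled_Add[OF scaled_umono])
  interpret T: ring_map twist by (rule ring_map_twist)
  obtain m where m: "phi0 D i j - phi0 D j i =
      dd D i * cartan D i j + 2 * (int (par D i) * int (par D j)) + 4 * m"
    using phi0_antisym by blast
  have c: "twist (base_emb (- (piR ^ (par D i * par D j)))) =
      tS powi (2 * int (par D i * par D j)) * base_emb (- (piR ^ (par D i * par D j)))"
    using twist_sign[of "par D i * par D j"] by (simp flip: piS_def)
  show "scaled (Smul (- (piR ^ (par D i * par D j))) (umono D [F j, E i] \<zeta>)) (word_exp [E i, F j] \<zeta>)"
  proof (rule scaled_cong[OF scaled_Smul[OF c scaled_umono]])
    have "twist_exp (E i) (\<zeta> + wt D (F j)) = twist_exp (E i) \<zeta> + exp_shift (E i) (F j)"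
      "twist_exp (F j) (\<zeta> + wt D (E i)) = twist_exp (F j) \<zeta> + exp_shift (F j) (E i)"
      by (rule twist_exp_add_wt)+
    then have "2 * int (par D i * par D j) + word_exp [F j, E i] \<zeta> - word_exp [E i, F j] \<zeta> =
        4 * (- m)"
      using m by simp
    then show "4 dvd 2 * int (par D i * par D j) + word_exp [F j, E i] \<zeta> - word_exp [E i, F j] \<zeta>"
      by (metis dvd_triv_left)
  qed
qed

text \<open>For \<open>i = j\<close> the contributions of \<open>phidot\<close> to \<open>E\<^sub>i F\<^sub>i\<close> cancel up to \<open>\<phi>(i,i) = d\<^sub>i\<close>, and what remains is
  the exponent of the quantum integer.\<close>

lemma scaled_comm_right:
  "scaled (if i = j then Smul (qint (v_at D i) (pi_at D i) (pairing D (simple_coroot D i) \<zeta>)) (Gen (Idem \<zeta>))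
      else Zero) (word_exp [E i, F j] \<zeta>)"
proof (cases "i = j")
  case True
  have "twist_exp (E i) (\<zeta> + wt D (F i)) = twist_exp (E i) \<zeta> + exp_shift (E i) (F i)"
    by (rule twist_exp_add_wt)
  then have "word_exp [E i, F i] \<zeta> = dd D i * (pairing D (simple_coroot D i) \<zeta> - 1) + gen_exp (Idem \<zeta>)"
    by (simp add: phi0_def cartan_same algebra_simps)
  then show ?thesis
    using True scaled_Smul[OF _ scaled_Gen, of _ _ "Idem \<zeta>"] twist_qint by (simp add: base_emb_at)
qed (simp add: scaled_Zero)

lemma exp_shift_serre:
  assumes "L = E \<or> L = F"
  shows "exp_shift (L j) (L i) - exp_shift (L i) (L j) = phi0 D i j - phi0 D j i"
  using assms dd_cartan_sym[of i j] by auto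

text \<open>The \<open>k\<close>-th summand acquires exponents from its power of \<open>\<pi>\<close>, from its binomial coefficient and from
  moving the letter \<open>j\<close>. By \<open>phi0_antisym\<close> their sum is congruent modulo 4 to \<open>k (k - 1) (p(i) - d\<^sub>i)\<close>, a product of two
  even numbers; so all summands scale like the summand with \<open>k = 0\<close>.\<close>

lemma scaled_serre:
  assumes "i \<noteq> j" and L: "L = E \<or> L = F"
  shows "\<exists>e. scaled (serre D L i j \<zeta>) e"
proof -
  interpret T: ring_map twist by (rule ring_map_twist)
  define b where "b = nat (bb D i j)"
  have "cartan D i j \<le> 0" using cartan_datum assms(1) by (simp add: super_cartan_datum_def)
  then have b: "bb D i j = int b" "int b = 1 - cartan D i j" by (simp_all add: b_def bb_def)
  define e where "e = word_exp (replicate b (L i) @ [L j]) \<zeta>"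
  obtain m where m: "phi0 D i j - phi0 D j i =
      dd D i * cartan D i j + 2 * (int (par D i) * int (par D j)) + 4 * m"
    using phi0_antisym by blast
  obtain r where r: "int (par D i) - dd D i = 2 * r" using dd_par by blast
  define s where "s = (\<lambda>k. Smul ((-1) ^ k * piR ^ ((k choose 2) * par D i + k * par D i * par D j) *
        qbinom (v_at D i) (pi_at D i) (bb D i j) k)
      (umono D (replicate (b - k) (L i) @ [L j] @ replicate k (L i)) \<zeta>))"
  have s: "scaled (s k) e" if "k \<le> b" for k
  proof -
    let ?n = "(k choose 2) * par D i + k * par D i * par D j"
    let ?c = "(-1) ^ k * piR ^ ?n * qbinom (v_at D i) (pi_at D i) (bb D i j) k"
    let ?a = "2 * int ?n + dd D i * (int k * (int b - int k))"
    have c: "twist (base_emb ?c) = tS powi ?a * base_emb ?c"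
    proof -
      have "twist (base_emb (piR ^ ?n)) = tS powi (2 * int ?n) * base_emb (piR ^ ?n)"
        using twist_sign[of ?n] by (simp only: ring_map.power[OF ring_map_base_emb] flip: piS_def)
      moreover have "twist (base_emb (qbinom (v_at D i) (pi_at D i) (bb D i j) k)) =
          tS powi (dd D i * (int k * (int b - int k))) * base_emb (qbinom (v_at D i) (pi_at D i) (bb D i j) k)"
        by (simp add: base_emb_at b(1) twist_qbinom)
      moreover have "twist (base_emb ((-1) ^ k)) = base_emb ((-1) ^ k)" by simp
      ultimately show ?thesis
        by (simp only: ring_map.mult[OF ring_map_base_emb] T.mult powi_add[OF tS_unit] mult_ac)
    qed
    have w: "word_exp (replicate (b - k) (L i) @ [L j] @ replicate k (L i)) \<zeta> =
        e + int k * (phi0 D i j - phi0 D j i)"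
      using word_exp_serre[of "b - k" "L i" "L j" k \<zeta>] that by (simp add: e_def exp_shift_serre[OF L])
    have k2: "2 * int (k choose 2) = int k * (int k - 1)"
    proof -
      have "even (k * (k - 1))" by (cases k) auto
      then have "2 * (k choose 2) = k * (k - 1)" by (simp add: choose_two)
      then have "2 * int (k choose 2) = int (k * (k - 1))" by (metis of_nat_mult of_nat_numeral)
      then show ?thesis by (cases k) (simp_all add: algebra_simps)
    qed
    (* Collecting the three sources of exponents and using twice that k choose 2 is half of
       k (k - 1): once for the exponent of pi, once to exhibit the factor 4. *)
    have "?a + (e + int k * (phi0 D i j - phi0 D j i)) - e =
        (2 * int (k choose 2)) * int (par D i) + 2 * int k * (int (par D i) * int (par D j)) +
        dd D i * (int k * (1 - cartan D i j - int k)) +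
        int k * (dd D i * cartan D i j + 2 * (int (par D i) * int (par D j)) + 4 * m)"
      unfolding b(2) m by (simp add: algebra_simps)
    also have "\<dots> = int k * (int k - 1) * (int (par D i) - dd D i) +
        4 * (int k * (int (par D i) * int (par D j) + m))"
      unfolding k2 by (simp add: algebra_simps)
    also have "\<dots> = 4 * (int (k choose 2) * r + int k * (int (par D i) * int (par D j) + m))"
      unfolding r k2[symmetric] by (simp add: algebra_simps)
    finally have four: "4 dvd ?a + (e + int k * (phi0 D i j - phi0 D j i)) - e"
      by (metis dvd_triv_left)
    show ?thesis
      unfolding s_def by (rule scaled_cong[OF scaled_Smul[OF c scaled_umono]]) (simp only: w four)
  qed
  have "scaled (foldr Add (map s ks) Zero) e" if "set ks \<subseteq> {..b}" for ks
    using that by (induction ks) (auto intro: scaled_Zero scaled_Add s)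
  from this[of "[0..<Suc b]"] have "scaled (foldr Add (map s [0..<Suc b]) Zero) e"
    by (simp add: atLeast0LessThan lessThan_Suc_atMost del: upt_Suc)
  then show ?thesis
    unfolding serre_def Let_def b_def[symmetric] s_def by blast
qed

lemma twist_relation:
  assumes "(x, y) \<in> udot_rels D"
  shows "twist_eval x = twist_eval y"
proof -
  have "ext x = ext y"
    using alg_cong.rel[OF assms] by (simp add: ext_def uclass_eq flip: aclass_eq_iff)
  moreover have "\<exists>e. scaled x e \<and> scaled y e"
    using assms
  proof cases
    case (idem \<zeta> \<zeta>')
    then show ?thesis
      using scaled_Mul[OF scaled_Gen scaled_Gen, of "Idem \<zeta>" "Idem \<zeta>'"] scaled_Gen[of "Idem \<zeta>"] scaled_Zero
      by (intro exI[of _ 0]) auto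
  next
    case (right z \<zeta> \<zeta>')
    then show ?thesis
      using scaled_Mul[OF scaled_Gen scaled_Gen, of "Chev z \<zeta>" "Idem \<zeta>'"] scaled_Gen[of "Chev z \<zeta>"] scaled_Zero
      by (intro exI[of _ "twist_exp z \<zeta>"]) auto
  next
    case (left \<zeta>' z \<zeta>)
    then show ?thesis
      using scaled_Mul[OF scaled_Gen scaled_Gen, of "Idem \<zeta>'" "Chev z \<zeta>"] scaled_Gen[of "Chev z \<zeta>"] scaled_Zero
      by (intro exI[of _ "twist_exp z \<zeta>"]) auto
  next
    case (comm i j \<zeta>)
    then show ?thesis using scaled_comm_left scaled_comm_right by blast
  next
    case (serre_E i j \<zeta>)
    then show ?thesis using scaled_serre[of i j E] scaled_Zero by blast
  next
    case (serre_F i j \<zeta>)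
    then show ?thesis using scaled_serre[of i j F] scaled_Zero by blast
  qed
  ultimately show ?thesis by (auto simp: scaled_def)
qed

end

section \<open>The semilinear automorphism\<close>

context root_datum
begin

sublocale twisted: presented_rep "udot_rels D" Ut "twist \<circ> base_emb" twist_gen
proof
  show "twist_gen g \<in> nu_carrier Ut" for g by (simp add: twist_gen_def ext_simps)
qed (simp_all add: twist_relation ring_map.mult[OF ring_map_twist] ring_map.add[OF ring_map_twist]
    ring_map.one[OF ring_map_twist])

text \<open>\<open>udot_twist\<close> is the semilinear map on the algebra over \<open>\<rat>(v)\<^sup>\<pi>\<close>, and \<open>Psi\<close> its extension to scalars with
  \<open>t\<close>. The detour is necessary because \<sigma> does not preserve \<open>\<rat>(v)\<^sup>\<pi>\<close>.\<close>

definition udot_twist where "udot_twist = presented_lift Ut (twist \<circ> base_emb) twist_gen"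

lemma semilinear_hom_udot_twist: "semilinear_hom (twist \<circ> base_emb) (Udot D) Ut udot_twist"
  using twisted.semilinear_hom_presented_lift by (simp add: udot_twist_def Udot_def)

sublocale twisted_ext: tensor_rep base_emb "Udot D" twist Ut udot_twist
proof -
  interpret ring_map twist by (rule ring_map_twist)
  interpret semilinear_hom "twist \<circ> base_emb" "Udot D" Ut udot_twist
    by (rule semilinear_hom_udot_twist)
  show "tensor_rep base_emb (Udot D) twist Ut udot_twist" ..
qed

definition Psi where "Psi = tens_lift Ut twist udot_twist"

lemma semilinear_hom_Psi: "semilinear_hom twist Ut Ut Psi"
  using twisted_ext.semilinear_hom_tens_lift by (simp add: Psi_def Udot_t_def)

sublocale Psi: semilinear_hom twist Ut Ut Psi
  by (rule semilinear_hom_Psi)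

lemma Psi_unit: "m \<in> nu_carrier (Udot D) \<Longrightarrow> Psi (unit m) = udot_twist m"
proof -
  assume m: "m \<in> nu_carrier (Udot D)"
  show ?thesis
    using twisted_ext.tens_lift[of "[(1, m)]"] m
    by (simp add: Psi_def unit_def ring_map.one[OF ring_map_twist])
qed

lemma Psi_ext: "Psi (ext x) = twist_eval x"
  using twisted.presented_lift[of x]
  by (simp add: ext_def Psi_unit) (simp add: udot_twist_def uclass_eq)

lemma Psi_scaled: "scaled x e \<Longrightarrow> Psi (ext x) = nu_smult Ut (tS powi e) (ext x)"
  by (simp add: Psi_ext scaled_def)

lemma Psi_gen: "Psi (ugen_t D g) = nu_smult Ut (tS powi gen_exp g) (ugen_t D g)"
  by (simp add: ugen_t_eq Psi_scaled scaled_Gen)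

lemma Ut_generated: "nu_carrier Ut \<subseteq> subalg_gen Ut UNIV (range (ugen_t D))"
proof
  fix X assume "X \<in> nu_carrier Ut"
  then obtain xs where X: "X = cls xs" "xs \<in> formal"
    using tensor_alg_simps(1) by (auto simp: Udot_t_def)
  let ?G = "range (\<lambda>g. uclass D (Gen g))"
  have "nu_carrier (Udot D) \<subseteq> subalg_gen (Udot D) UNIV ?G"
    using presented_alg_generated[of "udot_rels D"] by (simp add: Udot_def uclass_eq)
  then have "xs \<in> lists (UNIV \<times> subalg_gen (Udot D) UNIV ?G)"
    using X(2) unfolding formal_def by (meson Sigma_mono in_mono lists_mono order_refl)
  from cls_in_subalg_gen[OF ring_map_base_emb _ _ this]
  have "cls xs \<in> subalg_gen MT UNIV (unit ` ?G)"
    unfolding unit_def[abs_def] by (simp add: image_subset_iff)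
  moreover have "unit ` ?G = range (ugen_t D)"
    by (auto simp: ugen_t_eq ext_def)
  ultimately show "X \<in> subalg_gen Ut UNIV (range (ugen_t D))"
    using X(1) by (simp add: Udot_t_def)
qed

lemma twist_tS_powi: "twist (tS powi n) = tS powi n"
  by (simp add: ring_map_powi[OF ring_map_twist twist_inverse] twist_tS)

lemma Psi_order: "X \<in> nu_carrier Ut \<Longrightarrow> Psi (Psi (Psi (Psi X))) = X"
proof -
  assume X: "X \<in> nu_carrier Ut"
  have id: "twist \<circ> (twist \<circ> (twist \<circ> twist)) = (\<lambda>x. x)"
    by (auto simp: twist_order)
  have "semilinear_hom (twist \<circ> (twist \<circ> (twist \<circ> twist))) Ut Ut (Psi \<circ> (Psi \<circ> (Psi \<circ> Psi)))"
  proof -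
    have 2: "semilinear_hom (twist \<circ> twist) Ut Ut (Psi \<circ> Psi)"
      by (rule semilinear_hom_comp[OF semilinear_hom_Psi semilinear_hom_Psi])
    show ?thesis
      using semilinear_hom_comp[OF 2 2] by (simp add: comp_assoc)
  qed
  then have 4: "semilinear_hom (\<lambda>x. x) Ut Ut (Psi \<circ> (Psi \<circ> (Psi \<circ> Psi)))"
    unfolding id .
  have 1: "semilinear_hom (\<lambda>x. x) Ut Ut (\<lambda>x. x)"
    by unfold_locales simp_all
  have "(Psi \<circ> (Psi \<circ> (Psi \<circ> Psi))) X = (\<lambda>x. x) X"
  proof (rule semilinear_hom_eqI[OF 4 1])
    show "range (ugen_t D) \<subseteq> nu_carrier Ut" by (auto simp: ugen_t_eq ext_simps)
    show "X \<in> subalg_gen Ut UNIV (range (ugen_t D))" using X Ut_generated by blast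
    fix x assume "x \<in> range (ugen_t D)"
    then obtain g where g: "x = ugen_t D g" by blast
    have c: "ugen_t D g \<in> nu_carrier Ut" by (simp add: ugen_t_eq ext_simps)
    let ?e = "gen_exp g"
    have "tS powi ?e * (tS powi ?e * (tS powi ?e * tS powi ?e)) = tS powi (4 * ?e)"
      by (simp flip: powi_add[OF tS_unit])
    then have "Psi (Psi (Psi (Psi x))) = nu_smult Ut (tS powi (4 * ?e)) x"
      by (simp add: g Psi_gen Psi.hom_smult twist_tS_powi c mult.assoc flip: Ut.mult_smult)
    then show "(Psi \<circ> (Psi \<circ> (Psi \<circ> Psi))) x = x" by (simp add: tS_powi_4 g c)
  qed
  then show ?thesis by simp
qed

lemma bij_betw_Psi: "bij_betw Psi (nu_carrier Ut) (nu_carrier Ut)"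
  by (rule bij_betw_byWitness[of _ "\<lambda>X. Psi (Psi (Psi X))"]) (auto simp: Psi_order)

end

section \<open>The trivial module and the order of the automorphism\<close>

definition scalar_alg :: "('s::comm_ring_1, 's) nualg" where
  "scalar_alg = \<lparr>nu_carrier = UNIV, nu_zero = 0, nu_add = (+), nu_mult = (*), nu_smult = (*)\<rparr>"

lemma scalar_alg_simps:
  "nu_carrier scalar_alg = UNIV" "nu_zero scalar_alg = 0" "nu_add scalar_alg = (+)"
  "nu_mult scalar_alg = (*)" "nu_smult scalar_alg = (*)"
  by (simp_all add: scalar_alg_def)

lemma nu_algebra_scalar_alg: "nu_algebra scalar_alg"
  by standard (simp_all add: scalar_alg_simps algebra_simps)

context root_datum
begin

text \<open>The trivial module: \<open>1\<^sub>0\<close> acts by 1 and every other generator by 0. The commutator relation is respected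
  since the quantum integer \<open>[0]\<close> vanishes, and each term of the other relations that involve \<open>E\<close> or \<open>F\<close>
  contains such a letter.\<close>

fun counit_gen :: "('i, 'x) ugen \<Rightarrow> Qvtp" where
  "counit_gen (Idem \<zeta>) = (if \<zeta> = 0 then 1 else 0)"
| "counit_gen (Chev x \<zeta>) = 0"

lemma counit_umono:
  "xs \<noteq> [] \<Longrightarrow> term_eval scalar_alg base_emb counit_gen (umono D xs \<zeta>) = 0"
  by (cases xs) (simp_all add: scalar_alg_simps)

lemma counit_serre: "term_eval scalar_alg base_emb counit_gen (serre D L i j \<zeta>) = 0"
proof -
  have "term_eval scalar_alg base_emb counit_gen (foldr Add (map (\<lambda>k. Smul (c k) (umono D (w k) \<zeta>)) ks) Zero) = 0"
    if "\<And>k. w k \<noteq> []" for c w ks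
    using that
  proof (induction ks)
    case (Cons k ks)
    then show ?case using counit_umono[of "w k" \<zeta>] by (simp add: scalar_alg_simps)
  qed (simp add: scalar_alg_simps)
  note zero = this
  show ?thesis unfolding serre_def Let_def by (rule zero) simp
qed

lemma counit_relation:
  assumes "(x, y) \<in> udot_rels D"
  shows "term_eval scalar_alg base_emb counit_gen x = term_eval scalar_alg base_emb counit_gen y"
  using assms
proof cases
  case (comm i j \<zeta>)
  have "pairing D (simple_coroot D i) 0 = 0" for i
    using datum unfolding super_root_datum_def perfect_pairing_def biadditive_def
    by (simp add: additive.zero)
  then have "base_emb (qint (v_at D i) (pi_at D i) (pairing D (simple_coroot D i) 0)) = 0" for i
    by (simp add: qint_def divide_pi_ext_def)
  then show ?thesis
    using counit_umono[of "[E i, F j]" \<zeta>] counit_umono[of "[F j, E i]" \<zeta>]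
    unfolding comm by (simp add: scalar_alg_simps del: umono.simps)
qed (simp_all add: counit_serre, simp_all add: scalar_alg_simps)

text \<open>The extension of the trivial module to scalars with \<open>t\<close> sends \<open>c 1\<^sub>0\<close> to \<open>c\<close>.\<close>

lemma scalar_faithful:
  assumes "nu_smult Ut c (ugen_t D (Idem 0)) = nu_smult Ut d (ugen_t D (Idem 0))"
  shows "c = d"
proof -
  interpret S: nu_algebra "scalar_alg :: (Qvtp, Qvtp) nualg" by (rule nu_algebra_scalar_alg)
  interpret P: presented_rep "udot_rels D" scalar_alg base_emb counit_gen
    by unfold_locales (simp_all add: counit_relation, simp add: scalar_alg_simps)
  define \<epsilon> where "\<epsilon> = presented_lift scalar_alg base_emb counit_gen"
  have "semilinear_hom ((\<lambda>x. x) \<circ> base_emb) (Udot D) scalar_alg \<epsilon>"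
    using P.semilinear_hom_presented_lift by (simp add: \<epsilon>_def Udot_def comp_def)
  then have R: "tensor_rep base_emb (Udot D) (\<lambda>x. x) scalar_alg \<epsilon>"
    by (intro tensor_rep.intro ring_map_id tensor_axioms)
  let ?u = "uclass D (Gen (Idem 0))"
  have "\<epsilon> ?u = 1"
  proof -
    have "\<epsilon> ?u = term_eval scalar_alg base_emb counit_gen (Gen (Idem 0))"
      unfolding \<epsilon>_def uclass_eq by (rule P.presented_lift)
    then show ?thesis by (simp only: term_eval.simps counit_gen.simps simp_thms if_True)
  qed
  have *: "tens_lift scalar_alg (\<lambda>x. x) \<epsilon> (cls [(c, ?u)]) = c" for c
  proof -
    have "tens_lift scalar_alg (\<lambda>x. x) \<epsilon> (cls [(c, ?u)]) = tens_eval scalar_alg (\<lambda>x. x) \<epsilon> [(c, ?u)]"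
      by (rule tensor_rep.tens_lift[OF R]) simp
    also have "\<dots> = c" by (simp add: tens_eval_def scalar_alg_simps \<open>\<epsilon> ?u = 1\<close>)
    finally show ?thesis .
  qed
  have pure: "nu_smult Ut c (ugen_t D (Idem 0)) = cls [(c, ?u)]" for c
    using tensor_alg_simps(5)[of "[(1, ?u)]" c]
    by (simp add: ugen_t_eq ext_def unit_def Udot_t_def)
  have "c = tens_lift scalar_alg (\<lambda>x. x) \<epsilon> (cls [(c, ?u)])" by (rule *[symmetric])
  also have "cls [(c, ?u)] = cls [(d, ?u)]" unfolding pure[symmetric] by (rule assms)
  also have "tens_lift scalar_alg (\<lambda>x. x) \<epsilon> (cls [(d, ?u)]) = d" by (rule *)
  finally show ?thesis .
qed

lemma has_order_Psi: "has_order_on Psi (nu_carrier Ut) 4"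
  unfolding has_order_on_def
proof (intro conjI ballI allI impI)
  show "(Psi ^^ 4) x = x" if "x \<in> nu_carrier Ut" for x
    using Psi_order[OF that] by (simp add: numeral_eq_Suc)
  fix m :: nat assume m: "0 < m \<and> m < 4"
  let ?u = "ugen_t D (Idem 0)"
  have c: "?u \<in> nu_carrier Ut" by (simp add: ugen_t_eq ext_simps)
  have Psi_u: "Psi ?u = ?u" using Psi_gen[of "Idem 0"] c by simp
  (* Each application of Psi replaces a coefficient c by twist c, and twist vS = - tS * vS. *)
  have pow: "(Psi ^^ m) (nu_smult Ut vS ?u) = nu_smult Ut ((- tS) ^ m * vS) ?u" for m
  proof (induction m)
    case (Suc m)
    interpret T: ring_map twist by (rule ring_map_twist)
    show ?case
      using Suc c by (simp add: Psi.hom_smult Psi_u twist_tS twist_vS inverse_tS mult_ac)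
  qed simp
  have ne: "(- tS) ^ m \<noteq> 1"
  proof -
    have "m = 1 \<or> m = 2 \<or> m = 3" using m by auto
    moreover have "- tS \<noteq> 1" "- 1 \<noteq> (1 :: Qvtp)" "tS \<noteq> 1"
      by (simp_all add: tS_def one_pi_ext_def one_t_ext_def uminus_pi_ext_def uminus_t_ext_def zero_t_ext_def)
    moreover have "(- tS) ^ 2 = - 1" "(- tS) ^ 3 = tS"
      by (simp_all add: power2_eq_square power3_eq_cube tS_square)
    ultimately show ?thesis by auto
  qed
  have "(- tS) ^ m * vS \<noteq> vS"
  proof
    assume "(- tS) ^ m * vS = vS"
    then have "(- tS) ^ m * (vS * inverse vS) = vS * inverse vS" by (simp only: mult.assoc[symmetric])
    then show False using ne by (simp add: vS_unit)
  qed
  then have "(Psi ^^ m) (nu_smult Ut vS ?u) \<noteq> nu_smult Ut vS ?u"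
    using pow scalar_faithful by metis
  then show "\<exists>x\<in>nu_carrier Ut. (Psi ^^ m) x \<noteq> x" using c by auto
qed simp

end

section \<open>The integral form\<close>

lemma base_emb_Zvp: "base_emb ` Zvp \<subseteq> Zvtp"
proof -
  interpret B: ring_map base_emb by (rule ring_map_base_emb)
  have "base_emb x \<in> Zvtp" if "x \<in> Zvp" for x
    using that unfolding Zvp_def
    by induction (auto simp: Zvtp_def base_emb_inverse simp flip: vS_def piS_def intro: subring_gen.intros)
  then show ?thesis by blast
qed

lemma Zvtp_closed:
  "1 \<in> Zvtp" "x \<in> Zvtp \<Longrightarrow> y \<in> Zvtp \<Longrightarrow> x * y \<in> Zvtp" "x \<in> Zvtp \<Longrightarrow> - x \<in> Zvtp"
  "x \<in> Zvtp \<Longrightarrow> x ^ n \<in> Zvtp"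
proof -
  show one: "1 \<in> Zvtp" by (simp add: Zvtp_def subring_gen.one)
  show mult: "x * y \<in> Zvtp" if "x \<in> Zvtp" "y \<in> Zvtp" for x y
    using that unfolding Zvtp_def by (rule subring_gen.mult)
  show "- x \<in> Zvtp" if "x \<in> Zvtp" for x
    using subring_gen.diff[OF subring_gen.diff[OF subring_gen.one subring_gen.one], of x] that
    unfolding Zvtp_def by simp
  show "x ^ n \<in> Zvtp" if "x \<in> Zvtp"
    using that by (induction n) (auto intro: one mult)
qed

lemma Zvtp_gens: "vS \<in> Zvtp" "inverse vS \<in> Zvtp" "tS \<in> Zvtp" "piS \<in> Zvtp"
  by (auto simp: Zvtp_def intro: subring_gen.gen)

lemma tS_powi_Zvtp: "tS powi n \<in> Zvtp"
  by (simp add: power_int_def inverse_tS Zvtp_closed Zvtp_gens)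

lemma twist_Zvtp: "twist ` Zvtp \<subseteq> Zvtp"
proof -
  interpret T: ring_map twist by (rule ring_map_twist)
  have "twist x \<in> Zvtp" if "x \<in> Zvtp" for x
    using that unfolding Zvtp_def
  proof induction
    case (gen g)
    have "inverse (inverse tS * vS) = tS * inverse vS"
      using pi_ext_inverse_eqI[of "inverse tS" tS] tS_unit by (simp add: pi_ext_inverse_mult mult.commute)
    with gen show ?case
      using Zvtp_closed Zvtp_gens
      by (auto simp: twist_vS twist_tS twist_piS twist_inverse inverse_tS simp flip: Zvtp_def)
  qed (auto intro: subring_gen.intros)
  then show ?thesis by blast
qed

context root_datum
begin

definition divpow_gens where
  "divpow_gens = {uclass D (Gen (Idem \<zeta>)) | \<zeta>. True} \<union>
      {divpow D L i n \<zeta> | L i n \<zeta>. L \<in> {E, F} \<and> n \<ge> 1}"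

lemma divpow_closed: "divpow D L i n \<zeta> \<in> nu_carrier (Udot D)"
  by (simp add: divpow_def)

lemma divpow_gens_closed: "divpow_gens \<subseteq> nu_carrier (Udot D)"
  by (auto simp: divpow_gens_def divpow_closed)

lemma ZUdot_simps:
  "nu_carrier (ZUdot D) = subalg_gen (Udot D) Zvp divpow_gens"
  "nu_add (ZUdot D) = nu_add (Udot D)" "nu_mult (ZUdot D) = nu_mult (Udot D)"
  "nu_smult (ZUdot D) = nu_smult (Udot D)"
  by (simp_all add: ZUdot_def divpow_gens_def)

lemma ZUdot_closed: "nu_carrier (ZUdot D) \<subseteq> nu_carrier (Udot D)"
proof
  fix x assume "x \<in> nu_carrier (ZUdot D)"
  then show "x \<in> nu_carrier (Udot D)"
    unfolding ZUdot_simps by induction (use divpow_gens_closed in auto)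
qed

text \<open>Relations between integral tensors are relations between rational ones, so \<open>form_incl\<close> maps the
  integral class of a formal sum to its rational class.\<close>

lemma tens_cong_ZUdot:
  assumes "tens_cong Zvp base_emb Zvtp (ZUdot D) xs ys"
  shows "rel xs ys"
  using assms
proof (induction rule: tens_cong.induct)
  case (refl xs)
  then show ?case using ZUdot_closed by (intro rel_refl) (auto simp: formal_def)
next
  case (add_comm xs ys)
  then show ?case using ZUdot_closed by (intro rel_add_comm) (auto simp: formal_def)
qed (use ZUdot_closed in \<open>auto simp: ZUdot_simps(2-) intro: tens_cong.sym tens_cong.trans tens_cong.cong_add
      tens_cong.zero tens_cong.add_left tens_cong.add_right tens_cong.balanced\<close>)

lemma integral_form_lists: "integral_form D = cls ` lists (Zvtp \<times> nu_carrier (ZUdot D))"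
proof -
  have "form_incl D (tens_rel Zvp base_emb Zvtp (ZUdot D) `` {xs}) = cls xs"
    if "xs \<in> lists (Zvtp \<times> nu_carrier (ZUdot D))" for xs
    unfolding form_incl_def
  proof (rule SUP_eq_const)
    show "tens_rel Zvp base_emb Zvtp (ZUdot D) `` {xs} \<noteq> {}"
      using tens_cong.refl[OF that] by (auto simp: tens_rel_def)
    fix ys assume "ys \<in> tens_rel Zvp base_emb Zvtp (ZUdot D) `` {xs}"
    then have "rel xs ys" using tens_cong_ZUdot by (auto simp: tens_rel_def)
    then have "cls xs = cls ys" using cls_eq_iff cong_sums by blast
    then show "tens_rel UNIV base_emb UNIV (Udot D) `` {ys} = cls xs"
      by (simp add: tclass_def)
  qed
  then show ?thesis
    unfolding integral_form_def
    by (auto simp: ZUdot_t_def tensor_alg_def quotient_def image_iff)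
qed

text \<open>This presents the integral form as a subalgebra of the same kind as those to which
  \<open>semilinear_hom_subalg_gen\<close> applies.\<close>

lemma integral_form_eq: "integral_form D = subalg_gen Ut Zvtp (unit ` divpow_gens)"
proof
  show "integral_form D \<subseteq> subalg_gen Ut Zvtp (unit ` divpow_gens)"
    using cls_in_subalg_gen[OF ring_map_base_emb divpow_gens_closed base_emb_Zvp]
    unfolding integral_form_lists ZUdot_simps unit_def[abs_def] Udot_t_def by blast
next
  let ?L = "lists (Zvtp \<times> nu_carrier (ZUdot D))"
  have formal: "xs \<in> formal" if "xs \<in> ?L" for xs
    using that ZUdot_closed by (auto simp: formal_def)
  have "X \<in> cls ` ?L" if "X \<in> subalg_gen Ut Zvtp (unit ` divpow_gens)" for X
    using that
  proof induction
    case (gen X)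
    then obtain m where m: "m \<in> divpow_gens" "X = cls [(1, m)]" by (auto simp: unit_def)
    then have "[(1, m)] \<in> ?L" by (auto simp: Zvtp_closed ZUdot_simps intro: subalg_gen.gen)
    with m show ?case by blast
  next
    case zero
    then show ?case using tensor_alg_simps(2) by (auto simp: Udot_t_def)
  next
    case (add X Y)
    then obtain xs ys where xy: "X = cls xs" "Y = cls ys" "xs \<in> ?L" "ys \<in> ?L" by blast
    then have "xs @ ys \<in> ?L" by simp
    then show ?case
      using xy formal by (auto simp: Udot_t_def tensor_alg_simps)
  next
    case (mult X Y)
    then obtain xs ys where xy: "X = cls xs" "Y = cls ys" "xs \<in> ?L" "ys \<in> ?L" by blast
    then have "tens_mult (Udot D) xs ys \<in> ?L"
      by (fastforce simp: tens_mult_def in_lists_conv_set ZUdot_simps intro: Zvtp_closed subalg_gen.mult)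
    then show ?case
      using xy formal by (auto simp: Udot_t_def tensor_alg_simps)
  next
    case (smult c X)
    then obtain xs where x: "X = cls xs" "xs \<in> ?L" by blast
    then have "tens_smult c xs \<in> ?L"
      using smult(1) by (fastforce simp: tens_smult_def in_lists_conv_set intro: Zvtp_closed)
    then show ?case
      using x formal by (auto simp: Udot_t_def tensor_alg_simps)
  qed
  then show "subalg_gen Ut Zvtp (unit ` divpow_gens) \<subseteq> integral_form D"
    by (auto simp: integral_form_lists)
qed

text \<open>Both the monomial and the inverse quantum factorial are multiplied by a power of \<open>t\<close>.\<close>

lemma Psi_divpow:
  assumes "L \<in> {E, F}"
  shows "\<exists>e. Psi (unit (divpow D L i n \<zeta>)) = nu_smult Ut (tS powi e) (unit (divpow D L i n \<zeta>))"
proof -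
  let ?q = "qfact (v_at D i) (pi_at D i) n" and ?x = "umono D (replicate n (L i)) \<zeta>"
  obtain e where "twist (base_emb ?q) = tS powi e * base_emb ?q"
    using twist_qfact by (auto simp: base_emb_at)
  then have c: "twist (base_emb (inverse ?q)) = tS powi (- e) * base_emb (inverse ?q)"
    by (simp add: base_emb_inverse twist_inverse pi_ext_inverse_mult inverse_powi[OF tS_unit])
  have "unit (divpow D L i n \<zeta>) = ext (Smul (inverse ?q) ?x)"
    by (simp add: divpow_def unit.hom_smult ext_simps) (simp add: ext_def)
  then show ?thesis using Psi_scaled[OF scaled_Smul[OF c scaled_umono]] by auto
qed

lemma Psi_integral_form: "Psi ` integral_form D = integral_form D"
proof -
  have G: "unit ` divpow_gens \<subseteq> nu_carrier Ut" using divpow_gens_closed by auto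
  have "Psi x \<in> subalg_gen Ut Zvtp (unit ` divpow_gens)" if x: "x \<in> unit ` divpow_gens" for x
  proof -
    have "\<exists>e. Psi x = nu_smult Ut (tS powi e) x"
      using x Psi_divpow Psi_gen[of "Idem _"] unfolding divpow_gens_def
      by (auto simp: ugen_t_eq ext_def simp del: gen_exp.simps)
    then obtain e where "Psi x = nu_smult Ut (tS powi e) x" by blast
    then show ?thesis using x by (simp only:) (intro subalg_gen.smult tS_powi_Zvtp subalg_gen.gen)
  qed
  then have sub: "Psi ` integral_form D \<subseteq> integral_form D"
    unfolding integral_form_eq
    by (intro semilinear_hom_subalg_gen[OF semilinear_hom_Psi G _ twist_Zvtp]) blast
  have closed: "integral_form D \<subseteq> nu_carrier Ut"
  proof
    fix x assume "x \<in> integral_form D"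
    then show "x \<in> nu_carrier Ut" unfolding integral_form_eq by induction (use G in auto)
  qed
  have "integral_form D \<subseteq> Psi ` integral_form D"
  proof
    fix x assume x: "x \<in> integral_form D"
    then have "Psi (Psi (Psi x)) \<in> integral_form D" using sub by blast
    moreover have "x = Psi (Psi (Psi (Psi x)))" using x closed Psi_order by auto
    ultimately show "x \<in> Psi ` integral_form D" by blast
  qed
  with sub show ?thesis by blast
qed

end

section \<open>The automorphism of the modified covering quantum group\<close>

theorem theorem4p3:
  fixes D :: "('i::{finite, linorder}, 'y::ab_group_add, 'x::ab_group_add) super_datum"
    and C :: "'x set"
  assumes "super_root_datum D"
    and "transversal D C"
  shows "\<exists>\<sigma> \<Psi>.
    twist_scalar_aut \<sigma> \<and>
    semilinear_aut \<sigma> (Udot_t D) \<Psi> \<and>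
    has_order_on \<Psi> (nu_carrier (Udot_t D)) 4 \<and>
    (\<forall>\<zeta>. \<Psi> (ugen_t D (Idem \<zeta>)) = ugen_t D (Idem \<zeta>)) \<and>
    (\<forall>i \<zeta>. \<Psi> (ugen_t D (Chev (E i) \<zeta>)) =
       nu_smult (Udot_t D)
         (tS powi (dd D i * pairing D (simple_coroot D i) \<zeta> - phidot D C (frag_of i) \<zeta>))
         (ugen_t D (Chev (E i) \<zeta>))) \<and>
    (\<forall>i \<zeta>. \<Psi> (ugen_t D (Chev (F i) \<zeta>)) =
       nu_smult (Udot_t D) (tS powi (phidot D C (frag_of i) \<zeta>)) (ugen_t D (Chev (F i) \<zeta>))) \<and>
    \<Psi> ` integral_form D = integral_form D"
proof -
  interpret root_datum D C by unfold_locales fact+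
  show ?thesis
  proof (intro exI conjI allI)
    show "twist_scalar_aut twist" by (rule twist_scalar_aut_twist)
    show "semilinear_aut twist (Udot_t D) Psi"
      unfolding semilinear_aut_def
      using bij_betw_Psi Psi.hom_add Psi.hom_mult Psi.hom_smult by blast
    show "has_order_on Psi (nu_carrier (Udot_t D)) 4" by (rule has_order_Psi)
    show "Psi ` integral_form D = integral_form D" by (rule Psi_integral_form)
    show "Psi (ugen_t D (Idem \<zeta>)) = ugen_t D (Idem \<zeta>)" for \<zeta>
      using Psi_gen[of "Idem \<zeta>"] by (simp add: ugen_t_eq ext_simps)
  qed (simp_all add: Psi_gen)
qed

end
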